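(* Let $H(X,Y,q)$ be the mirror curve polynomial described in the context, and let $D$ and $c$ be as in the context. There is $\epsilon>0$ such that for every $q\in(\mathbb{R}^* )^p$ with $|q_k|<\epsilon$ for all $k$ and with $a_i(q)<0$ whenever $m_i$ and $n_i$ are both odd and $a_i(q)>0$ whenever $m_i$ or $n_i$ is even, the following holds: for every interior lattice point $b_i=(m_i,n_i)$ of $P$ there exists a unique connected component $W_{b_i}$ of the closure of $\{(x,y)\in(\mathbb{R}^* )^2:H(x,y,q)=0\}$ in the real toric surface $\mathbb{R}X_P$, contained in $(\mathbb{R}^* )^2$, such that every point $(x_0,y_0)\in W_{b_i}$ satisfies $$(1+c)\,|a_i(q)x_0^{m_i}y_0^{n_i}|>|a_j(q)x_0^{m_j}y_0^{n_j}|\quad\text{for all }j\neq i.$$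
   Context: Let $P\subset\mathbb{R}^2$ be a convex lattice polygon with a unimodular triangulation $T_\Sigma$ (triangles with lattice vertices and area $1/2$; vertex set $P\cap\mathbb{Z}^2$), encoding a smooth toric Calabi–Yau 3-fold. Write $P\cap\mathbb{Z}^2=\{b_1,\dots,b_{p+3}\}$, $b_i=(m_i,n_i)$, with $b_1=(1,0)$, $b_2=(0,1)$, $b_3=(0,0)$ and $\sigma_1=\{b_1,b_2,b_3\}$ a triangle of $T_\Sigma$. Let $L=\ker(\mathbb{Z}^{p+3}\to\mathbb{Z}^3,\ e_i\mapsto(m_i,n_i,1))$, $D_i\in L^\vee$ the restriction of the $i$-th coordinate functional; for a triangle $\sigma$ with vertex index set $I'_\sigma$, $\{D_j:j\notin I'_\sigma\}$ is a basis of $L^\vee\otimes\mathbb{Q}$. Fix $H_1,\dots,H_p\in L^\vee\otimes\mathbb{Q}$ with $H_k=\sum_{j\notin I'_\sigma}s^\sigma_{k,j}D_j$, $s^\sigma_{k,j}\in\mathbb{Z}_{\ge0}$, $(s^\sigma_{k,j})$ nondegenerate, for every triangle $\sigma$. Set $a_i(q)=1$ ($i=1,2,3$), $a_i(q)=\prod_k q_k^{s^{\sigma_1}_{k,i}}$ ($i\ge4$), and $H(X,Y,q)=\sum_{i=1}^{p+3}a_i(q)X^{m_i}Y^{n_i}$. $X_P$ is the projective toric surface of $P$ and $\mathbb{R}X_P$ the closure of $(\mathbb{R}^* )^2$ in it. A flag is an ordered triple $(b_{i_1},b_{i_2},b_{i_3})$ of the vertices of a triangle of $T_\Sigma$ in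 counterclockwise order; the coordinates of a lattice point $b_j$ with respect to it are the integers $(m',n')$ with $b_j=b_{i_3}+m'(b_{i_1}-b_{i_3})+n'(b_{i_2}-b_{i_3})$. $D$ is a fixed real number with $D\ge\sqrt{m'^2+n'^2}$ for all flags and all lattice points of $P$, and $c>0$ is a fixed constant (independent of $q$) with $(1+c)^{2D}<4/3$. *)

theory Defs
  imports "HOL-Analysis.Analysis"
begin

text \<open>Lattice points b_i = (m_i, n_i) are given by b :: nat => int * int on the index
  set {1..N}, N = p + 3.  pt b i is b_i viewed in R^2.\<close>

definition pt :: "(nat \<Rightarrow> int \<times> int) \<Rightarrow> nat \<Rightarrow> real \<times> real" where
  "pt b i = (real_of_int (fst (b i)), real_of_int (snd (b i)))"

definition det2 :: "real \<times> real \<Rightarrow> real \<times> real \<Rightarrow> real" where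
  "det2 u v = fst u * snd v - snd u * fst v"

definition lattice_points :: "(real \<times> real) set \<Rightarrow> (int \<times> int) set" where
  "lattice_points P = {z. (real_of_int (fst z), real_of_int (snd z)) \<in> P}"

definition convex_lattice_polygon :: "(real \<times> real) set \<Rightarrow> bool" where
  "convex_lattice_polygon P \<longleftrightarrow>
     (\<exists>S. finite S \<and> S \<subseteq> {(real_of_int m, real_of_int n) | m n. True}
          \<and> P = convex hull S) \<and> interior P \<noteq> {}"

definition unimodular_triangulation ::
  "(real \<times> real) set \<Rightarrow> (nat \<Rightarrow> int \<times> int) \<Rightarrow> nat \<Rightarrow> nat set set \<Rightarrow> bool" where
  "unimodular_triangulation P b N T \<longleftrightarrow>
     finite T \<and> \<Union>T = {1..N} \<and>
     (\<forall>\<sigma>\<in>T. \<exists>i j k. \<sigma> = {i, j, k} \<and>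
         \<bar>det2 (pt b j - pt b i) (pt b k - pt b i)\<bar> = 1) \<and>
     (\<Union>\<sigma>\<in>T. convex hull (pt b ` \<sigma>)) = P \<and>
     (\<forall>\<sigma>\<in>T. \<forall>\<tau>\<in>T. convex hull (pt b ` \<sigma>) \<inter> convex hull (pt b ` \<tau>)
                       = convex hull (pt b ` (\<sigma> \<inter> \<tau>)))"

definition is_flag :: "(nat \<Rightarrow> int \<times> int) \<Rightarrow> nat set set \<Rightarrow> nat \<Rightarrow> nat \<Rightarrow> nat \<Rightarrow> bool" where
  "is_flag b T i1 i2 i3 \<longleftrightarrow> {i1, i2, i3} \<in> T \<and>
     det2 (pt b i1 - pt b i3) (pt b i2 - pt b i3) > 0"

text \<open>L \<otimes> Q = kernel of Q^N -> Q^3, e_i |-> (m_i, n_i, 1); vectors supported on {1..N}.\<close>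
definition LQ :: "(nat \<Rightarrow> int \<times> int) \<Rightarrow> nat \<Rightarrow> (nat \<Rightarrow> rat) set" where
  "LQ b N = {v. (\<forall>i. i \<notin> {1..N} \<longrightarrow> v i = 0) \<and>
                (\<Sum>i=1..N. v i * of_int (fst (b i))) = 0 \<and>
                (\<Sum>i=1..N. v i * of_int (snd (b i))) = 0 \<and>
                (\<Sum>i=1..N. v i) = 0}"

text \<open>a_i(q); s \<sigma> k j stands for s^\<sigma>_{k,j}; \<sigma>_1 = {1,2,3}.\<close>
definition a_coef :: "nat \<Rightarrow> (nat set \<Rightarrow> nat \<Rightarrow> nat \<Rightarrow> nat) \<Rightarrow> (nat \<Rightarrow> real) \<Rightarrow> nat \<Rightarrow> real" where
  "a_coef p s q i = (if i \<in> {1, 2, 3} then 1 else (\<Prod>k=1..p. q k ^ s {1, 2, 3} k i))"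

definition mirror_H ::
  "(nat \<Rightarrow> int \<times> int) \<Rightarrow> nat \<Rightarrow> (nat set \<Rightarrow> nat \<Rightarrow> nat \<Rightarrow> nat) \<Rightarrow> (nat \<Rightarrow> real) \<Rightarrow> real \<Rightarrow> real \<Rightarrow> real" where
  "mirror_H b p s q X Y =
     (\<Sum>i=1..p+3. a_coef p s q i * X powi fst (b i) * Y powi snd (b i))"

definition real_torus :: "(real \<times> real) set" where
  "real_torus = {(x, y). x \<noteq> 0 \<and> y \<noteq> 0}"

definition real_curve ::
  "(nat \<Rightarrow> int \<times> int) \<Rightarrow> nat \<Rightarrow> (nat set \<Rightarrow> nat \<Rightarrow> nat \<Rightarrow> nat) \<Rightarrow> (nat \<Rightarrow> real) \<Rightarrow> (real \<times> real) set" where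
  "real_curve b p s q = {(x, y) \<in> real_torus. mirror_H b p s q x y = 0}"

text \<open>Model of the real toric surface RX_P: X_P is embedded in P^{N-1} by the monomials of
  all lattice points of P, (x,y) |-> [x^m_i y^n_i]_i, and P^{N-1}(R) is identified
  (homeomorphically) with the rank-one orthogonal projections [v] |-> v v^T / |v|^2
  (matrices indexed by {1..N} x {1..N}, entries outside are 0).  RX_P is the closure of
  the image of (R^*)^2.\<close>
definition mono_vec :: "(nat \<Rightarrow> int \<times> int) \<Rightarrow> nat \<Rightarrow> real \<times> real \<Rightarrow> nat \<Rightarrow> real" where
  "mono_vec b N z i = (if i \<in> {1..N} then fst z powi fst (b i) * snd z powi snd (b i) else 0)"

definition toric_embed :: "(nat \<Rightarrow> int \<times> int) \<Rightarrow> nat \<Rightarrow> real \<times> real \<Rightarrow> (nat \<times> nat \<Rightarrow> real)" where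
  "toric_embed b N z = (\<lambda>(i, j). mono_vec b N z i * mono_vec b N z j /
                                   (\<Sum>k=1..N. (mono_vec b N z k)\<^sup>2))"

definition real_toric_surface :: "(nat \<Rightarrow> int \<times> int) \<Rightarrow> nat \<Rightarrow> (nat \<times> nat \<Rightarrow> real) set" where
  "real_toric_surface b N = closure (toric_embed b N ` real_torus)"

definition curve_closure ::
  "(nat \<Rightarrow> int \<times> int) \<Rightarrow> nat \<Rightarrow> (nat set \<Rightarrow> nat \<Rightarrow> nat \<Rightarrow> nat) \<Rightarrow> (nat \<Rightarrow> real) \<Rightarrow> (nat \<times> nat \<Rightarrow> real) set" where
  "curve_closure b p s q = real_toric_surface b (p + 3) \<inter> closure (toric_embed b (p + 3) ` real_curve b p s q)"

end

theory Submission
  imports Defs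
begin

text \<open>Fix an interior lattice point \<open>b\<^sub>i\<close> and a quadrant. In logarithmic coordinates, \<open>H\<close> divided by the
  monomial of \<open>b\<^sub>i\<close> is \<open>F = 1 + \<Sum>\<^sub>j \<tau>\<^sub>j exp \<lambda>\<^sub>j\<close> with affine functions \<open>\<lambda>\<^sub>j\<close> and signs \<open>\<tau>\<^sub>j\<close>, and the
  asserted inequality says that every \<open>\<lambda>\<^sub>j\<close> is less than \<open>ln (1 + c)\<close>. For a triangle \<open>{i, k, l}\<close> and
  \<open>b\<^sub>j - b\<^sub>i = m (b\<^sub>k - b\<^sub>i) + n (b\<^sub>l - b\<^sub>i)\<close>, evaluating the classes \<open>H\<^sub>k\<close> on the corresponding affine relation gives
  \<open>\<lambda>\<^sub>j \<le> m \<lambda>\<^sub>k + n \<lambda>\<^sub>l - \<Lambda>\<close> with \<open>\<Lambda> = - ln \<epsilon>\<close>. As the triangles at \<open>b\<^sub>i\<close> cover all directions, in that region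
  only the neighbours of \<open>b\<^sub>i\<close> contribute noticeably to \<open>F\<close>.

  In exactly one quadrant all neighbours have sign \<open>-1\<close>. There \<open>F\<close> is positive at a point where all \<open>\<lambda>\<^sub>j\<close>
  are very negative, negative on the boundary of the region, and decreasing along rays from that point
  wherever it is not positive, so its zero set in the region is mapped homeomorphically onto the circle of rays.

  In the other quadrants two adjacent neighbours are never both negative. At a zero in the region some
  negative neighbour \<open>k\<close> has a large term. Let \<open>{i, k, l}\<close> and \<open>{i, k, l'}\<close> be the triangles at its edge.
  Since \<open>exp \<lambda>\<^sub>k < 1 + c\<close>, the terms of \<open>l\<close> and \<open>l'\<close> are smaller than about \<open>c\<close>, and \<open>F\<close> is
  strictly decreasing in \<open>\<lambda>\<^sub>k\<close> at fixed \<open>\<lambda>\<^sub>l\<close>. Hence the zero set is locally a graph over \<open>\<lambda>\<^sub>l\<close>, and a component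
  lying in the region could not contain a point with \<open>\<lambda>\<^sub>l\<close> maximal.\<close>

section \<open>Topological and elementary preliminaries\<close>

text \<open>A continuous injection of a compact set into a Hausdorff space is a homeomorphism onto
  its image. This is applied to a graph over an interval and to the oval projected radially onto a
  circle.\<close>

lemma connected_if_inj_image_connected:
  fixes f :: "'a::topological_space \<Rightarrow> 'b::t2_space"
  assumes "compact S" "continuous_on S f" "inj_on f S" "connected (f ` S)"
  shows "connected S"
proof -
  have "continuous_on (f ` S) (the_inv_into S f)"
    using assms by (intro continuous_on_inv) (auto simp: the_inv_into_f_f)
  then have "connected (the_inv_into S f ` f ` S)"
    using assms(4) connected_continuous_image by blast
  moreover have "the_inv_into S f ` f ` S = S"
    using assms(3) by (force simp: image_image the_inv_into_f_f)
  ultimately show ?thesis by simp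
qed

lemma det2_lin:
  "det2 u (m *\<^sub>R u + n *\<^sub>R v) = n * det2 u v" "det2 (m *\<^sub>R u + n *\<^sub>R v) v = m * det2 u v"
  "det2 u v = - det2 v u"
  by (auto simp: det2_def algebra_simps)

text \<open>A hands-on implicit function theorem: near the origin \<open>f\<close> is strictly
  decreasing in the first variable, so its zeros form a graph over the second one. Only
  \<open>t \<ge> 0\<close> is kept, because the graph serves to move upwards from a supposed maximum
  of \<open>t\<close>.\<close>

lemma zero_curve_ascends:
  fixes f f' :: "real \<Rightarrow> real \<Rightarrow> real"
  assumes cont: "continuous_on UNIV (\<lambda>z. f (fst z) (snd z))"
    and cont': "continuous_on UNIV (\<lambda>z. f' (fst z) (snd z))"
    and der: "\<And>s t. ((\<lambda>s. f s t) has_real_derivative f' s t) (at s)"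
    and zero: "f 0 0 = 0" and neg: "f' 0 0 < 0" and "e > 0"
  obtains S where "connected S" "S \<subseteq> {z. f (fst z) (snd z) = 0 \<and> \<bar>fst z\<bar> \<le> e \<and> \<bar>snd z\<bar> \<le> e}"
    "(0, 0) \<in> S" "\<exists>z\<in>S. snd z > 0"
proof -
  have 1: "open ((\<lambda>z. f' (fst z) (snd z)) -` {..<0})"
    using cont' open_vimage[of "{..<0::real}"] by auto
  have 2: "(0, 0) \<in> (\<lambda>z. f' (fst z) (snd z)) -` {..<0}" using neg by simp
  obtain A B where AB: "open A" "open B" "(0, 0) \<in> A \<times> B"
    "A \<times> B \<subseteq> (\<lambda>z. f' (fst z) (snd z)) -` {..<0}"
    by (rule open_prod_elim[OF 1 2])
  obtain d1 where d1: "d1 > 0" "cball 0 d1 \<subseteq> A"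
    using AB(1,3) unfolding open_contains_cball by auto
  obtain d2 where d2: "d2 > 0" "cball 0 d2 \<subseteq> B"
    using AB(2,3) unfolding open_contains_cball by auto
  define d where "d = min e (min d1 d2)"
  have d: "d > 0" "d \<le> e" "d \<le> d1" "d \<le> d2" using d1 d2 \<open>e > 0\<close> by (auto simp: d_def)
  have f'neg: "f' s t < 0" if "\<bar>s\<bar> \<le> d" "\<bar>t\<bar> \<le> d" for s t
  proof -
    have "s \<in> A" "t \<in> B" using that d d1 d2 by (auto simp: subset_iff)
    then show ?thesis using AB(4) by auto
  qed
  have decr: "f s' t < f s t" if "s < s'" "\<bar>s\<bar> \<le> d" "\<bar>s'\<bar> \<le> d" "\<bar>t\<bar> \<le> d" for s s' t
    by (rule DERIV_neg_imp_decreasing[OF that(1)]) (use that in \<open>auto intro!: exI[of _ "f' _ t"] der f'neg\<close>)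
  have cs: "continuous_on UNIV (\<lambda>t. f s t)" for s
    by (rule continuous_on_compose2[OF cont, of _ "\<lambda>t. (s, t)", simplified]) (auto intro!: continuous_intros)
  have ct: "continuous_on UNIV (\<lambda>s. f s t)" for t
    by (rule continuous_on_compose2[OF cont, of _ "\<lambda>s. (s, t)", simplified]) (auto intro!: continuous_intros)
  \<comment> \<open>The opposite signs at the two ends of the box persist for small
    \<open>t\<close>. The intermediate value theorem then gives a zero for each such
    \<open>t\<close>, and \<open>decr\<close> makes it unique.\<close>
  have "f d 0 < 0" "f (-d) 0 > 0" using decr[of 0 d 0] decr[of "-d" 0 0] zero d by auto
  moreover have "open {t. f d t < 0}" "open {t. f (-d) t > 0}"
    using open_Collect_less[OF cs continuous_on_const] open_Collect_less[OF continuous_on_const cs] by auto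
  ultimately have "open ({t. f d t < 0} \<inter> {t. f (-d) t > 0})" "0 \<in> {t. f d t < 0} \<inter> {t. f (-d) t > 0}" by auto
  then obtain h0 where h0: "h0 > 0" "cball 0 h0 \<subseteq> {t. f d t < 0} \<inter> {t. f (-d) t > 0}"
    by (metis open_contains_cball)
  define h where "h = min d h0"
  have h: "h > 0" "h \<le> d" using h0 d by (auto simp: h_def)
  have fs: "f d t < 0" "f (-d) t > 0" if "0 \<le> t" "t \<le> h" for t
  proof -
    have "t \<in> cball 0 h0" using that by (auto simp: h_def)
    then show "f d t < 0" "f (-d) t > 0" using h0(2) by blast+
  qed
  define S where "S = {z. f (fst z) (snd z) = 0} \<inter> ({-d..d} \<times> {0..h})"
  have "closed {z. f (fst z) (snd z) = 0}"
    by (rule closed_Collect_eq[OF cont continuous_on_const])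
  then have comp: "compact S"
    unfolding S_def by (intro closed_Int_compact compact_Times) auto
  have inj: "inj_on snd S"
  proof (rule inj_onI)
    fix x y assume "x \<in> S" "y \<in> S" "snd x = snd y"
    then show "x = y"
      using decr[of "fst x" "fst y" "snd x"] decr[of "fst y" "fst x" "snd x"] h
      by (cases "fst x" "fst y" rule: linorder_cases) (auto simp: S_def prod_eq_iff mem_Times_iff abs_le_iff)
  qed
  have ex: "\<exists>s. (s, t) \<in> S" if "t \<in> {0..h}" for t
  proof -
    have "\<exists>s\<ge>-d. s \<le> d \<and> f s t = 0"
      by (rule IVT2') (use fs[of t] that d ct in \<open>auto intro: continuous_on_subset\<close>)
    then show ?thesis using that by (auto simp: S_def)
  qed
  have img: "snd ` S = {0..h}"
  proof
    show "snd ` S \<subseteq> {0..h}" by (auto simp: S_def)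
    show "{0..h} \<subseteq> snd ` S" using ex by (metis image_eqI snd_conv subsetI)
  qed
  show thesis
  proof
    show "connected S"
      by (rule connected_if_inj_image_connected[OF comp _ inj])
        (auto simp: img intro!: continuous_intros)
    show "S \<subseteq> {z. f (fst z) (snd z) = 0 \<and> \<bar>fst z\<bar> \<le> e \<and> \<bar>snd z\<bar> \<le> e}"
      using d h by (auto simp: S_def)
    show "(0, 0) \<in> S" using zero d h by (auto simp: S_def)
    show "\<exists>z\<in>S. snd z > 0" using ex[of h] h by force
  qed
qed

text \<open>If every term were below \<open>a / n\<close>, the sum would be below \<open>a\<close>.
  Allowing any \<open>n\<close> at least the cardinality lets \<open>card J\<close> stand in for the
  number of neighbours.\<close>

lemma exists_ge_average:
  fixes g :: "'a \<Rightarrow> real"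
  assumes "finite S" "a \<le> sum g S" "a > 0" "card S \<le> n"
  obtains k where "k \<in> S" "a / n \<le> g k"
proof -
  have "\<exists>k\<in>S. a / n \<le> g k"
  proof (rule ccontr)
    assume "\<not> ?thesis"
    then have lt: "\<And>k. k \<in> S \<Longrightarrow> g k < a / n" by auto
    have ne: "S \<noteq> {}" using assms by auto
    have "sum g S < (\<Sum>k\<in>S. a / n)"
      by (rule sum_strict_mono) (use assms ne lt in auto)
    also have "\<dots> \<le> a"
    proof -
      have "real (card S) * a \<le> real n * a" using assms by (intro mult_right_mono) auto
      moreover have "n > 0" using ne assms by (metis card_gt_0_iff le_zero_eq neq0_conv)
      ultimately show ?thesis by (simp add: field_simps)
    qed
    finally show False using assms by simp
  qed
  then show thesis using that by blast
qed

lemma mult_exp_minus_le_one: "x * exp (- x) \<le> (1::real)"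
proof -
  have "x \<le> exp x" using exp_ge_add_one_self[of x] by linarith
  then show ?thesis by (simp add: exp_minus field_simps)
qed

section \<open>Sparse exponential sums around a centre\<close>

text \<open>\<open>J\<close> indexes the lattice points other than the centre, \<open>d j\<close> is their position relative to it, and
  \<open>(k, l) \<in> E\<close> means that \<open>k\<close> and \<open>l\<close> form a triangle with the centre, in either order. The last two
  assumptions are what ``\<open>q\<close> small'' amounts to.\<close>
locale star =
  fixes J :: "nat set" and E :: "(nat \<times> nat) set" and d :: "nat \<Rightarrow> real \<times> real"
    and \<alpha> \<tau> :: "nat \<Rightarrow> real" and M :: nat and c \<Lambda> :: real
  assumes fin: "finite J"
    and E_sub: "(k, l) \<in> E \<Longrightarrow> k \<in> J \<and> l \<in> J"
    and E_sym: "(k, l) \<in> E \<Longrightarrow> (l, k) \<in> E"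
    and E_det: "(k, l) \<in> E \<Longrightarrow> det2 (d k) (d l) \<noteq> 0"
    and d_nz: "j \<in> J \<Longrightarrow> d j \<noteq> 0"
    and cone: "\<exists>k l m n. (k, l) \<in> E \<and> m \<ge> 0 \<and> n \<ge> 0 \<and> w = m *\<^sub>R d k + n *\<^sub>R d l"
    and coords: "(k, l) \<in> E \<Longrightarrow> j \<in> J \<Longrightarrow>
      \<exists>m n :: int. d j = of_int m *\<^sub>R d k + of_int n *\<^sub>R d l \<and> \<bar>m\<bar> \<le> int M \<and> \<bar>n\<bar> \<le> int M"
    and rel: "(k, l) \<in> E \<Longrightarrow> j \<in> J \<Longrightarrow> j \<noteq> k \<Longrightarrow> j \<noteq> l \<Longrightarrow> d j = m *\<^sub>R d k + n *\<^sub>R d l \<Longrightarrow>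
      \<alpha> j \<le> m * \<alpha> k + n * \<alpha> l - \<Lambda>"
    and side: "(k, l) \<in> E \<Longrightarrow> \<exists>l'. (k, l') \<in> E \<and> det2 (d k) (d l) * det2 (d k) (d l') < 0"
    and tau: "j \<in> J \<Longrightarrow> \<bar>\<tau> j\<bar> = 1"
    and c_pos: "c > 0"
    and Mc: "real M * c \<le> 1 / 3"
    and small: "real (card J) * real M * exp (real M * (2 * real (card J) + 2 * c) - \<Lambda>) < min c (1 / 18)"
    and deep: "\<Lambda> \<ge> 10 * real (card J) * real M + 5 * real (card J)"
begin

definition lam :: "nat \<Rightarrow> real \<times> real \<Rightarrow> real" where
  "lam j z = \<alpha> j + d j \<bullet> z"

definition F :: "real \<times> real \<Rightarrow> real" where
  "F z = 1 + (\<Sum>j\<in>J. \<tau> j * exp (lam j z))"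

text \<open>The derivative of \<open>F\<close> at \<open>z\<close> in direction \<open>w\<close>, as
  \<open>F_deriv\<close> shows.\<close>

definition dF :: "real \<times> real \<Rightarrow> real \<times> real \<Rightarrow> real" where
  "dF z w = (\<Sum>j\<in>J. \<tau> j * (d j \<bullet> w) * exp (lam j z))"

definition nb :: "nat set" where "nb = fst ` E"

definition L :: real where "L = ln (1 + c)"

text \<open>A common bound for all negligible terms. One \<open>2 * c\<close> accounts for two
  functions that are at most \<open>c\<close>; the \<open>2 * card J\<close> accounts for one
  function that is only known to be at least \<open>- 2 * card J\<close> and may carry a negative
  coefficient.\<close>

definition \<kappa> :: real where "\<kappa> = exp (real M * (2 * real (card J) + 2 * c) - \<Lambda>)"

text \<open>Only the neighbours are constrained, and not strictly. This gives a compact convex set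
  on which the terms of all other points are small automatically.\<close>

definition region :: "(real \<times> real) set" where "region = {z. \<forall>k\<in>nb. lam k z \<le> L}"

definition ovals :: "(real \<times> real) set" where "ovals = {z. F z = 0 \<and> (\<forall>j\<in>J. lam j z < L)}"

lemma nb_sub: "nb \<subseteq> J" using E_sub by (auto simp: nb_def)

lemma fin_nb: "finite nb" using nb_sub fin finite_subset by blast

lemma E_nb: "(k, l) \<in> E \<Longrightarrow> k \<in> nb \<and> l \<in> nb"
  using E_sym by (force simp: nb_def)

lemma E_ne: "(k, l) \<in> E \<Longrightarrow> k \<noteq> l"
  using E_det by (force simp: det2_def)

lemma card_pos: "real (card J) \<ge> 1"
proof -
  obtain k l where "(k, l) \<in> E" using cone by blast
  then show ?thesis using E_sub fin by (metis One_nat_def Suc_leI card_gt_0_iff empty_iff of_nat_1 of_nat_le_iff)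
qed

lemma coords_unique:
  assumes "(k, l) \<in> E" "m *\<^sub>R d k + n *\<^sub>R d l = m' *\<^sub>R d k + n' *\<^sub>R d l"
  shows "m = m'" "n = n'"
  using E_det[OF assms(1)] det2_lin(1)[of "d k" m n "d l"] det2_lin(1)[of "d k" m' n' "d l"]
    det2_lin(2)[of m "d k" n "d l"] det2_lin(2)[of m' "d k" n' "d l"] assms(2)
  by auto

text \<open>The coordinates of \<open>d k\<close> in a basis containing it are 1 and 0, and
  \<open>M\<close> bounds them.\<close>

lemma M_pos: "M \<ge> 1"
proof -
  obtain k l where kl: "(k, l) \<in> E" using cone by blast
  then obtain m n :: int where mn: "d k = of_int m *\<^sub>R d k + of_int n *\<^sub>R d l" "\<bar>m\<bar> \<le> int M"
    using coords[of k l k] E_sub by blast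
  have "real_of_int m = 1"
    using coords_unique(1)[OF kl, of "of_int m" "of_int n" 1 0] mn(1) by simp
  then show ?thesis using mn(2) by linarith
qed

lemma L_bounds: "0 < L" "L \<le> c" "exp L = 1 + c"
  using c_pos ln_add_one_self_le_self[of c] by (auto simp: L_def)

lemma kappa_pos: "\<kappa> > 0" by (simp add: \<kappa>_def)

lemma kappa_small:
  "real (card J) * real M * \<kappa> < 1 / 18" "real (card J) * \<kappa> < 1 / 18" "real (card J) * \<kappa> < c" "\<kappa> < 1 / 18"
proof -
  have a: "real (card J) * real M * \<kappa> < min c (1 / 18)" using small by (simp add: \<kappa>_def)
  have b: "real (card J) * \<kappa> \<le> real (card J) * real M * \<kappa>"
    using mult_right_mono[of 1 "real M" "real (card J) * \<kappa>"] M_pos kappa_pos by (simp add: mult_ac)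
  have "\<kappa> \<le> real (card J) * \<kappa>" using mult_right_mono[OF card_pos, of \<kappa>] kappa_pos by simp
  then show "real (card J) * real M * \<kappa> < 1 / 18" "real (card J) * \<kappa> < 1 / 18"
    "real (card J) * \<kappa> < c" "\<kappa> < 1 / 18" using a b by auto
qed

lemma lam_diff: "d j = m *\<^sub>R d k + n *\<^sub>R d l \<Longrightarrow>
    lam j z - lam j z' = m * (lam k z - lam k z') + n * (lam l z - lam l z')"
  by (simp add: lam_def inner_add_left algebra_simps)

text \<open>The linear parts of \<open>lam j\<close> and \<open>m * lam k + n * lam l\<close> agree,
  so their difference is a constant, which \<open>rel\<close> bounds.\<close>

lemma lam_rel:
  assumes "(k, l) \<in> E" "j \<in> J" "j \<noteq> k" "j \<noteq> l" "d j = m *\<^sub>R d k + n *\<^sub>R d l"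
  shows "lam j z \<le> m * lam k z + n * lam l z - \<Lambda>"
  using rel[OF assms] assms(5) by (simp add: lam_def inner_add_left algebra_simps)

text \<open>Some cone contains \<open>d j\<close>, with nonnegative real coefficients; by uniqueness
  these are the integer coordinates bounded by \<open>M\<close>.\<close>

lemma cone_coords:
  assumes "j \<in> J"
  obtains k l m n where "(k, l) \<in> E" "d j = real m *\<^sub>R d k + real n *\<^sub>R d l" "m \<le> M" "n \<le> M" "m + n \<ge> 1"
proof -
  obtain k l m' n' where E: "(k, l) \<in> E" "m' \<ge> 0" "n' \<ge> 0" "d j = m' *\<^sub>R d k + n' *\<^sub>R d l"
    using cone[of "d j"] by blast
  obtain m n where mn: "d j = of_int m *\<^sub>R d k + of_int n *\<^sub>R d l" "\<bar>m\<bar> \<le> int M" "\<bar>n\<bar> \<le> int M"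
    using coords[OF E(1) assms] by blast
  have "of_int m = m'" "of_int n = n'"
    using coords_unique[OF E(1), of "of_int m" "of_int n" m' n'] mn(1) E(4) by simp_all
  then have pos: "m \<ge> 0" "n \<ge> 0" using E by auto
  moreover have "m \<noteq> 0 \<or> n \<noteq> 0" using d_nz[OF assms] mn(1) by auto
  ultimately show thesis using that[of k l "nat m" "nat n"] E(1) mn by fastforce
qed

lemma lin_le: "a \<le> C \<Longrightarrow> 0 \<le> C \<Longrightarrow> m \<le> M' \<Longrightarrow> 0 \<le> m \<Longrightarrow> m * a \<le> M' * (C::real)"
  by (meson mult_left_mono mult_right_mono order_trans)

lemma of_int_le_real: "m \<le> int k \<Longrightarrow> real_of_int m \<le> real k"
  by (metis of_int_le_iff of_int_of_nat_eq)

text \<open>In the triangle whose cone contains \<open>d j\<close> both coefficients are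
  nonnegative, so upper bounds on \<open>lam k\<close> and \<open>lam l\<close> suffice, however
  negative these functions may be.\<close>

lemma far_bound:
  assumes "j \<in> J - nb" "z \<in> region"
  shows "exp (lam j z) \<le> \<kappa>"
proof -
  obtain k l m n where kl: "(k, l) \<in> E" "d j = real m *\<^sub>R d k + real n *\<^sub>R d l" "m \<le> M" "n \<le> M"
    using cone_coords[of j] assms by blast
  have "j \<noteq> k" "j \<noteq> l" using assms E_nb[OF kl(1)] by auto
  then have "lam j z \<le> real m * lam k z + real n * lam l z - \<Lambda>"
    using lam_rel[OF kl(1) _ _ _ kl(2)] assms by auto
  moreover have "real m * lam k z \<le> real M * c" "real n * lam l z \<le> real M * c"
    using assms(2) E_nb[OF kl(1)] L_bounds kl c_pos
    by (auto simp: region_def intro!: lin_le)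
  moreover have "0 \<le> real M * (2 * real (card J))" by simp
  ultimately have "lam j z \<le> real M * (2 * real (card J) + 2 * c) - \<Lambda>"
    unfolding distrib_left by linarith
  then show ?thesis by (simp add: \<kappa>_def)
qed

lemma sum_far_bound:
  assumes "z \<in> region"
  shows "(\<Sum>j\<in>J - nb. exp (lam j z)) \<le> real (card J) * \<kappa>"
proof -
  have "(\<Sum>j\<in>J - nb. exp (lam j z)) \<le> (\<Sum>j\<in>J - nb. \<kappa>)"
    by (rule sum_mono) (use far_bound assms in auto)
  also have "\<dots> \<le> real (card J) * \<kappa>"
    using kappa_pos card_mono[OF fin, of "J - nb"] by (simp add: mult_right_mono)
  finally show ?thesis .
qed

lemma F_split: "F z = 1 + (\<Sum>k\<in>nb. \<tau> k * exp (lam k z)) + (\<Sum>j\<in>J - nb. \<tau> j * exp (lam j z))"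
  using sum.subset_diff[OF nb_sub fin, of "\<lambda>j. \<tau> j * exp (lam j z)"] by (simp add: F_def)

lemma abs_sum_tau: "A \<subseteq> J \<Longrightarrow> (\<And>j. j \<in> A \<Longrightarrow> g j \<ge> 0) \<Longrightarrow> \<bar>\<Sum>j\<in>A. \<tau> j * g j\<bar> \<le> sum g A"
  by (rule order.trans[OF sum_abs]) (auto intro!: sum_mono simp: abs_mult tau subset_iff)

lemma sum_far_abs:
  assumes "z \<in> region"
  shows "\<bar>\<Sum>j\<in>J - nb. \<tau> j * exp (lam j z)\<bar> \<le> real (card J) * \<kappa>"
  using sum_far_bound[OF assms] abs_sum_tau[of "J - nb" "\<lambda>j. exp (lam j z)"] by auto

lemma lam_continuous: "continuous_on A (lam j)"
  unfolding lam_def by (intro continuous_intros)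

lemma F_continuous: "continuous_on A F"
  unfolding F_def by (intro continuous_intros lam_continuous)

lemma dF_continuous: "continuous_on A (\<lambda>z. dF z w)"
  unfolding dF_def by (intro continuous_intros lam_continuous)

lemma F_deriv: "((\<lambda>s. F (x + s *\<^sub>R w)) has_real_derivative dF (x + s *\<^sub>R w) w) (at s)"
  unfolding F_def dF_def lam_def
  by (auto intro!: derivative_eq_intros sum.cong simp: inner_add_right)

lemma dF_scale: "dF z (s *\<^sub>R w) = s * dF z w"
  by (auto simp: dF_def sum_distrib_left intro!: sum.cong)

text \<open>Write \<open>w\<close> itself as a nonnegative combination of two neighbours and take
  the inner product with \<open>w\<close>.\<close>

lemma spans_positive:
  assumes "w \<noteq> 0"
  obtains k where "k \<in> nb" "d k \<bullet> w > 0"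
proof -
  obtain k l m n where "(k, l) \<in> E" "m \<ge> 0" "n \<ge> 0" and w: "w = m *\<^sub>R d k + n *\<^sub>R d l"
    using cone by blast
  moreover have "m * (d k \<bullet> w) + n * (d l \<bullet> w) > 0"
  proof -
    have "w \<bullet> w > 0" using assms by simp
    also have "w \<bullet> w = m * (d k \<bullet> w) + n * (d l \<bullet> w)"
      by (subst (1) w) (simp add: inner_add_left)
    finally show ?thesis .
  qed
  ultimately have "d k \<bullet> w > 0 \<or> d l \<bullet> w > 0"
    by (smt (verit) mult_nonneg_nonpos)
  then show thesis using that E_nb[OF \<open>(k, l) \<in> E\<close>] by blast
qed

text \<open>Every linear functional is bounded above on the region, because its direction is a
  nonnegative combination of neighbours. The four axis directions give a bounding box.\<close>

lemma region_compact: "compact region"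
proof -
  have ub: "\<exists>C. \<forall>z\<in>region. w \<bullet> z \<le> C" for w
  proof -
    obtain k l m n where kl: "(k, l) \<in> E" "m \<ge> 0" "n \<ge> 0" "w = m *\<^sub>R d k + n *\<^sub>R d l"
      using cone by blast
    have "w \<bullet> z \<le> m * (L - \<alpha> k) + n * (L - \<alpha> l)" if "z \<in> region" for z
    proof -
      have "d k \<bullet> z \<le> L - \<alpha> k" "d l \<bullet> z \<le> L - \<alpha> l"
        using that E_nb[OF kl(1)] by (force simp: region_def lam_def)+
      then have "m * (d k \<bullet> z) \<le> m * (L - \<alpha> k)" "n * (d l \<bullet> z) \<le> n * (L - \<alpha> l)"
        using kl by (auto intro!: mult_left_mono)
      then show ?thesis using kl(4) by (simp add: inner_add_left)
    qed
    then show ?thesis by blast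
  qed
  obtain C1 C2 C3 C4 where C: "\<And>z. z \<in> region \<Longrightarrow> (1, 0) \<bullet> z \<le> C1" "\<And>z. z \<in> region \<Longrightarrow> (-1, 0) \<bullet> z \<le> C2"
    "\<And>z. z \<in> region \<Longrightarrow> (0, 1) \<bullet> z \<le> C3" "\<And>z. z \<in> region \<Longrightarrow> (0, -1) \<bullet> z \<le> C4"
    using ub[of "(1, 0)"] ub[of "(-1, 0)"] ub[of "(0, 1)"] ub[of "(0, -1)"] by metis
  have "region \<subseteq> {-C2..C1} \<times> {-C4..C3}"
  proof
    fix z assume z: "z \<in> region"
    show "z \<in> {-C2..C1} \<times> {-C4..C3}"
      using C(1-4)[OF z] by (cases z) auto
  qed
  then have "bounded region"
    by (rule bounded_subset[rotated]) (intro bounded_Times bounded_closed_interval)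
  moreover have "closed region"
  proof -
    have "closed (\<Inter>k\<in>nb. {z. lam k z \<le> L})"
      by (intro closed_INT ballI closed_Collect_le lam_continuous continuous_on_const)
    moreover have "region = (\<Inter>k\<in>nb. {z. lam k z \<le> L})" by (auto simp: region_def)
    ultimately show ?thesis by simp
  qed
  ultimately show ?thesis by (simp add: compact_eq_bounded_closed)
qed

end

section \<open>The quadrant in which all neighbours have sign -1\<close>

context star
begin

text \<open>Cramer's rule gives a point where the functions of one triangle both equal
  \<open>- 5 * card J\<close>. Every other \<open>lam j\<close> is then at most
  \<open>10 * card J * M - \<Lambda>\<close>, which \<open>deep\<close> makes small enough.\<close>

lemma deep_point:
  obtains z0 where "\<And>j. j \<in> J \<Longrightarrow> lam j z0 \<le> - 5 * real (card J)"
proof -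
  obtain k l where kl: "(k, l) \<in> E" using cone by blast
  define D where "D = det2 (d k) (d l)"
  have D: "D \<noteq> 0" using E_det[OF kl] by (simp add: D_def)
  define a b where "a = - 5 * real (card J) - \<alpha> k" and "b = - 5 * real (card J) - \<alpha> l"
  define z0 where "z0 = ((a * snd (d l) - b * snd (d k)) / D, (b * fst (d k) - a * fst (d l)) / D)"
  have "d k \<bullet> z0 = a * (fst (d k) * snd (d l) - snd (d k) * fst (d l)) / D"
    by (simp add: z0_def inner_prod_def field_simps add_divide_distrib[symmetric] diff_divide_distrib[symmetric])
  then have "d k \<bullet> z0 = a" using D by (simp add: D_def det2_def)
  then have zk: "lam k z0 = - 5 * real (card J)" by (simp add: lam_def a_def)
  have "d l \<bullet> z0 = b * (fst (d k) * snd (d l) - snd (d k) * fst (d l)) / D"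
    by (simp add: z0_def inner_prod_def field_simps add_divide_distrib[symmetric] diff_divide_distrib[symmetric])
  then have "d l \<bullet> z0 = b" using D by (simp add: D_def det2_def)
  then have zl: "lam l z0 = - 5 * real (card J)" by (simp add: lam_def b_def)
  have "lam j z0 \<le> - 5 * real (card J)" if j: "j \<in> J" for j
  proof (cases "j = k \<or> j = l")
    case False
    obtain m n where mn: "d j = of_int m *\<^sub>R d k + of_int n *\<^sub>R d l" "\<bar>m\<bar> \<le> int M" "\<bar>n\<bar> \<le> int M"
      using coords[OF kl j] by blast
    have "lam j z0 \<le> of_int m * lam k z0 + of_int n * lam l z0 - \<Lambda>"
      using lam_rel[OF kl j _ _ mn(1)] False by auto
    also have "\<dots> = 5 * real (card J) * (- of_int m - of_int n) - \<Lambda>" by (simp add: zk zl algebra_simps)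
    also have "\<dots> \<le> 5 * real (card J) * (2 * real M) - \<Lambda>"
      using mn by (intro diff_right_mono mult_left_mono) (auto simp flip: of_int_minus of_int_add of_int_diff)
    also have "\<dots> \<le> - 5 * real (card J)" using deep by (simp add: algebra_simps)
    finally show ?thesis .
  qed (use zk zl in auto)
  then show thesis using that by blast
qed

text \<open>The change of \<open>lam j\<close> is a combination of the changes of
  \<open>lam k\<close> and \<open>lam l\<close> with nonnegative coefficients, so it can be charged
  to those two neighbours.\<close>

lemma far_derivative_bound:
  assumes "j \<in> J - nb" "z \<in> region"
  shows "\<bar>lam j z - lam j z0\<bar> * exp (lam j z)
    \<le> real M * \<kappa> * (\<Sum>k\<in>nb. \<bar>lam k z - lam k z0\<bar> * exp (lam k z))"
proof -
  obtain k l m n where kl: "(k, l) \<in> E" "d j = real m *\<^sub>R d k + real n *\<^sub>R d l" "m \<le> M" "n \<le> M"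
    using cone_coords[of j] assms by blast
  have "j \<noteq> k" "j \<noteq> l" using assms E_nb[OF kl(1)] by auto
  then have le: "lam j z \<le> real m * lam k z + real n * lam l z - \<Lambda>"
    using lam_rel[OF kl(1) _ _ _ kl(2)] assms by auto
  have zkl: "lam k z \<le> c" "lam l z \<le> c"
    using assms(2) E_nb[OF kl(1)] L_bounds by (auto simp: region_def)
  have nn: "0 \<le> real M * (2 * real (card J))" by simp
  \<comment> \<open>If \<open>m \<ge> 1\<close>, one copy of \<open>lam k z\<close> is split off
    before estimating, which keeps the factor \<open>exp (lam k z)\<close>; for \<open>m = 0\<close>
    there is nothing to charge.\<close>
  have one: "real m * exp (lam j z) \<le> real M * (\<kappa> * exp (lam k z))"
  proof (cases "m = 0")
    case False
    have "real m * lam k z + real n * lam l z = lam k z + (real (m - 1) * lam k z + real n * lam l z)"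
      using False by (cases m) (auto simp: algebra_simps)
    also have "\<dots> \<le> lam k z + (real M * c + real M * c)"
      using zkl kl c_pos by (intro add_mono order_refl lin_le) auto
    finally have "lam j z \<le> (real M * (2 * real (card J) + 2 * c) - \<Lambda>) + lam k z"
      unfolding distrib_left using nn le by linarith
    then have "exp (lam j z) \<le> \<kappa> * exp (lam k z)" by (simp add: \<kappa>_def flip: exp_add)
    then show ?thesis using kl by (intro mult_mono) auto
  qed (use kappa_pos in auto)
  have two: "real n * exp (lam j z) \<le> real M * (\<kappa> * exp (lam l z))"
  proof (cases "n = 0")
    case False
    have "real m * lam k z + real n * lam l z = lam l z + (real m * lam k z + real (n - 1) * lam l z)"
      using False by (cases n) (auto simp: algebra_simps)
    also have "\<dots> \<le> lam l z + (real M * c + real M * c)"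
      using zkl kl c_pos by (intro add_mono order_refl lin_le) auto
    finally have "lam j z \<le> (real M * (2 * real (card J) + 2 * c) - \<Lambda>) + lam l z"
      unfolding distrib_left using nn le by linarith
    then have "exp (lam j z) \<le> \<kappa> * exp (lam l z)" by (simp add: \<kappa>_def flip: exp_add)
    then show ?thesis using kl by (intro mult_mono) auto
  qed (use kappa_pos in auto)
  let ?D = "\<lambda>k. \<bar>lam k z - lam k z0\<bar>"
  have "?D j \<le> real m * ?D k + real n * ?D l"
    unfolding lam_diff[OF kl(2)] by (rule order.trans[OF abs_triangle_ineq]) (simp add: abs_mult)
  then have "?D j * exp (lam j z) \<le> (real m * ?D k + real n * ?D l) * exp (lam j z)"
    by (intro mult_right_mono) auto
  also have "\<dots> = ?D k * (real m * exp (lam j z)) + ?D l * (real n * exp (lam j z))"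
    by (simp add: algebra_simps)
  also have "\<dots> \<le> ?D k * (real M * (\<kappa> * exp (lam k z))) + ?D l * (real M * (\<kappa> * exp (lam l z)))"
    using one two by (intro add_mono mult_left_mono) auto
  also have "\<dots> = real M * \<kappa> * (\<Sum>k\<in>{k, l}. ?D k * exp (lam k z))"
    using E_ne[OF kl(1)] by (simp add: algebra_simps)
  also have "\<dots> \<le> real M * \<kappa> * (\<Sum>k\<in>nb. ?D k * exp (lam k z))"
    using kappa_pos E_nb[OF kl(1)] fin_nb by (intro mult_left_mono sum_mono2) auto
  finally show ?thesis .
qed

text \<open>Since \<open>F z \<le> 0\<close>, some neighbour has a term at least
  \<open>1 / (2 * card J)\<close>. Its function has risen by at least \<open>3 * card J\<close>
  since \<open>z0\<close>, which contributes at least 3/2 to \<open>S\<close>. Neighbours whose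
  function has fallen cost at most 2/5 in total, and the remaining points at most
  \<open>S / 18\<close>.\<close>

lemma radial_derivative_neg:
  assumes nbneg: "\<And>k. k \<in> nb \<Longrightarrow> \<tau> k = - 1"
    and z0: "\<And>j. j \<in> J \<Longrightarrow> lam j z0 \<le> - 5 * real (card J)"
    and z: "z \<in> region" "F z \<le> 0"
  shows "dF z (z - z0) < 0"
proof -
  let ?n = "real (card J)"
  let ?D = "\<lambda>k. lam k z - lam k z0"
  define S where "S = (\<Sum>k\<in>nb. \<bar>?D k\<bar> * exp (lam k z))"
  define A where "A = (\<Sum>k\<in>nb. ?D k * exp (lam k z))"
  have "(\<Sum>k\<in>nb. \<tau> k * exp (lam k z)) = - (\<Sum>k\<in>nb. exp (lam k z))"
    by (simp add: nbneg flip: sum_negf)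
  then have "1 - ?n * \<kappa> \<le> (\<Sum>k\<in>nb. exp (lam k z))"
    using z(2) sum_far_abs[OF z(1)] F_split[of z] by linarith
  then have "1 / 2 \<le> (\<Sum>k\<in>nb. exp (lam k z))" using kappa_small(2) by linarith
  then obtain k where k: "k \<in> nb" "1 / 2 / ?n \<le> exp (lam k z)"
    using exists_ge_average[OF fin_nb _ _ card_mono[OF fin nb_sub]] by (metis half_gt_zero zero_less_one)
  have "exp (- lam k z) \<le> 2 * ?n"
    using k(2) card_pos by (simp add: exp_minus field_simps)
  then have "- lam k z + 1 \<le> 2 * ?n" using exp_ge_add_one_self[of "- lam k z"] by linarith
  then have Dk: "?D k \<ge> 3 * ?n" using z0[of k] k(1) nb_sub by (auto simp: subset_iff)
  \<comment> \<open>Where \<open>lam l\<close> has fallen, \<open>x * exp (- x) \<le> 1\<close> and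
    the depth of \<open>z0\<close> make the term tiny. The factor 2 comes from replacing
    \<open>?D l\<close> by its absolute value.\<close>
  have low: "?D l * exp (lam l z) \<ge> (\<bar>?D l\<bar> * exp (lam l z)) - 2 * exp (- 5 * ?n)" if "l \<in> nb" for l
  proof (cases "?D l \<ge> 0")
    case False
    have "lam l z0 \<le> - 5 * ?n" using z0 that nb_sub by auto
    have "- ?D l * exp (lam l z) = (- ?D l * exp (?D l)) * exp (lam l z0)"
      by (simp flip: exp_add)
    also have "\<dots> \<le> 1 * exp (- 5 * ?n)"
      using mult_exp_minus_le_one[of "- ?D l"] \<open>lam l z0 \<le> - 5 * ?n\<close> by (intro mult_mono) auto
    finally have "- ?D l * exp (lam l z) \<le> exp (- 5 * ?n)" by simp
    moreover have "\<bar>?D l\<bar> = - ?D l" using False by simp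
    ultimately show ?thesis by (simp add: algebra_simps)
  qed simp
  have "A \<ge> S - (\<Sum>l\<in>nb. 2 * exp (- 5 * ?n))"
    unfolding A_def S_def sum_subtractf[symmetric] by (rule sum_mono) (use low in auto)
  moreover have "(\<Sum>l\<in>nb. 2 * exp (- 5 * ?n)) \<le> ?n * (2 * exp (- 5 * ?n))"
    using card_mono[OF fin nb_sub] by (simp add: mult_right_mono)
  moreover have "5 * ?n * exp (- (5 * ?n)) \<le> 1" by (rule mult_exp_minus_le_one)
  ultimately have A: "A \<ge> S - 2 / 5" unfolding minus_mult_left[symmetric] by linarith
  have "3 * ?n * (1 / 2 / ?n) \<le> \<bar>?D k\<bar> * exp (lam k z)"
    using Dk k by (intro mult_mono) auto
  also have "\<dots> \<le> S" unfolding S_def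
    using k fin_nb by (intro member_le_sum) auto
  finally have S: "S \<ge> 3 / 2" using card_pos by simp
  have "\<bar>\<Sum>j\<in>J - nb. \<tau> j * (?D j * exp (lam j z))\<bar> \<le> (\<Sum>j\<in>J - nb. \<bar>?D j\<bar> * exp (lam j z))"
    by (rule order.trans[OF sum_abs]) (auto intro!: sum_mono simp: abs_mult tau)
  also have "\<dots> \<le> (\<Sum>j\<in>J - nb. real M * \<kappa> * S)"
    unfolding S_def by (rule sum_mono) (use far_derivative_bound z in auto)
  also have "\<dots> \<le> ?n * (real M * \<kappa> * S)"
    using card_mono[OF fin, of "J - nb"] S kappa_pos by (simp add: mult_right_mono)
  also have "\<dots> = ?n * real M * \<kappa> * S" by simp
  also have "\<dots> \<le> 1 / 18 * S" using kappa_small(1) S by (intro mult_right_mono) auto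
  finally have far: "\<bar>\<Sum>j\<in>J - nb. \<tau> j * (?D j * exp (lam j z))\<bar> \<le> 1 / 18 * S" .
  have "dF z (z - z0) = (\<Sum>j\<in>J. \<tau> j * (?D j * exp (lam j z)))"
    by (simp add: dF_def lam_def inner_diff_right mult.assoc)
  also have "\<dots> = (\<Sum>k\<in>nb. \<tau> k * (?D k * exp (lam k z))) + (\<Sum>j\<in>J - nb. \<tau> j * (?D j * exp (lam j z)))"
    using sum.subset_diff[OF nb_sub fin, of "\<lambda>j. \<tau> j * (?D j * exp (lam j z))"] by simp
  also have "(\<Sum>k\<in>nb. \<tau> k * (?D k * exp (lam k z))) = - A"
    unfolding A_def by (simp add: nbneg flip: sum_negf)
  finally show ?thesis using far A S by linarith
qed

text \<open>The term of \<open>k\<close> alone contributes \<open>- (1 + c)\<close>, and the points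
  that are not neighbours contribute less than \<open>c\<close>.\<close>

lemma boundary_neg:
  assumes nbneg: "\<And>k. k \<in> nb \<Longrightarrow> \<tau> k = - 1"
    and z: "z \<in> region" "k \<in> nb" "lam k z = L"
  shows "F z < 0"
proof -
  have "exp (lam k z) \<le> (\<Sum>k\<in>nb. exp (lam k z))"
    using z(2) fin_nb by (intro member_le_sum) auto
  moreover have "(\<Sum>k\<in>nb. \<tau> k * exp (lam k z)) = - (\<Sum>k\<in>nb. exp (lam k z))"
    by (simp add: nbneg flip: sum_negf)
  moreover have "exp (lam k z) = 1 + c" using z(3) L_bounds by simp
  ultimately show ?thesis
    using sum_far_abs[OF z(1)] F_split[of z] kappa_small(3) by linarith
qed

text \<open>No zero lies on the boundary of the region, so the strict inequalities may be relaxed to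
  closed ones; this is what makes \<open>ovals\<close> compact.\<close>

lemma ovals_eq:
  assumes nbneg: "\<And>k. k \<in> nb \<Longrightarrow> \<tau> k = - 1"
  shows "ovals = {z. F z = 0} \<inter> region"
proof
  show "ovals \<subseteq> {z. F z = 0} \<inter> region"
    using nb_sub by (force simp: ovals_def region_def)
  show "{z. F z = 0} \<inter> region \<subseteq> ovals"
  proof
    fix z assume z: "z \<in> {z. F z = 0} \<inter> region"
    have "lam j z < L" if j: "j \<in> J" for j
    proof (cases "j \<in> nb")
      case True
      then have "lam j z \<le> L" "lam j z \<noteq> L"
        using z boundary_neg[OF nbneg, of z j] by (auto simp: region_def)
      then show ?thesis by simp
    next
      case False
      then have "exp (lam j z) < exp L"
        using far_bound[of j z] z j kappa_small(4) c_pos L_bounds(3) by auto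
      then show ?thesis by simp
    qed
    then show "z \<in> ovals" using z by (auto simp: ovals_def)
  qed
qed

lemma lam_ray: "lam j (x + t *\<^sub>R w) = lam j x + t * (d j \<bullet> w)"
  by (simp add: lam_def inner_add_right)

text \<open>Strict decrease is known only where \<open>F\<close> is not positive, so two zeros
  cannot be compared by monotonicity directly; a minimum over the segment between them is examined
  instead.\<close>

lemma ray_zero_unique:
  assumes nbneg: "\<And>k. k \<in> nb \<Longrightarrow> \<tau> k = - 1"
    and z0: "\<And>j. j \<in> J \<Longrightarrow> lam j z0 \<le> - 5 * real (card J)"
    and t: "0 < t1" "t1 < t2" "z0 + t1 *\<^sub>R w \<in> region" "z0 + t2 *\<^sub>R w \<in> region"
      "F (z0 + t1 *\<^sub>R w) = 0"
  shows "F (z0 + t2 *\<^sub>R w) \<noteq> 0"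
proof
  let ?g = "\<lambda>t. F (z0 + t *\<^sub>R w)"
  assume F2: "?g t2 = 0"
  have neg: "dF (z0 + t *\<^sub>R w) w < 0" if "t1 \<le> t" "t \<le> t2" "?g t \<le> 0" for t
  proof -
    \<comment> \<open>The region is convex, and both ends of the segment lie in it.\<close>
    have "z0 + t *\<^sub>R w \<in> region"
    proof -
      have "lam k z0 + t * (d k \<bullet> w) \<le> L" if "k \<in> nb" for k
      proof -
        have a: "lam k z0 + t1 * (d k \<bullet> w) \<le> L" "lam k z0 + t2 * (d k \<bullet> w) \<le> L"
          using t that by (auto simp: region_def lam_ray)
        show ?thesis
        proof (cases "d k \<bullet> w \<ge> 0")
          case True
          then have "t * (d k \<bullet> w) \<le> t2 * (d k \<bullet> w)" using \<open>t \<le> t2\<close> by (intro mult_right_mono)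
          then show ?thesis using a by linarith
        next
          case False
          then have "t * (d k \<bullet> w) \<le> t1 * (d k \<bullet> w)" using \<open>t1 \<le> t\<close> by (intro mult_right_mono_neg) auto
          then show ?thesis using a by linarith
        qed
      qed
      then show ?thesis by (simp add: region_def lam_ray)
    qed
    from radial_derivative_neg[OF nbneg z0 this that(3)]
    have "dF (z0 + t *\<^sub>R w) (t *\<^sub>R w) < 0" by simp
    then show ?thesis using t that by (simp add: dF_scale mult_less_0_iff)
  qed
  \<comment> \<open>The minimum over the segment is negative, hence interior, where the derivative would vanish.\<close>
  have "continuous_on {t1..t2} ?g"
    by (intro continuous_on_compose2[OF F_continuous[of UNIV]] continuous_intros) auto
  then obtain m where m: "m \<in> {t1..t2}" "\<And>t. t \<in> {t1..t2} \<Longrightarrow> ?g m \<le> ?g t"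
    using continuous_attains_inf[of "{t1..t2}" ?g] t by auto
  obtain e where e: "e > 0" "\<And>h. 0 < h \<Longrightarrow> h < e \<Longrightarrow> ?g (t1 + h) < ?g t1"
    using DERIV_neg_dec_right[OF F_deriv[of z0 w t1]] neg[of t1] t by auto
  define h where "h = min (e / 2) (t2 - t1)"
  have "?g (t1 + h) < 0" "t1 + h \<in> {t1..t2}" using e t by (auto simp: h_def min_def)
  then have gm: "?g m < 0" using m(2) by fastforce
  then have ne: "t1 < m" "m < t2" using m(1) t(5) F2 by (auto simp: less_le)
  define r where "r = min (m - t1) (t2 - m)"
  have "dF (z0 + m *\<^sub>R w) w = 0"
    by (rule DERIV_local_min[OF F_deriv, of r]) (use ne m in \<open>auto simp: r_def abs_less_iff\<close>)
  then show False using neg[of m] gm m(1) by simp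
qed

text \<open>\<open>T k\<close> is the time at which the ray leaves the region, namely the first time
  some neighbour reaches the value \<open>L\<close>. There \<open>F\<close> is negative, and at
  \<open>z0\<close> it is positive.\<close>

lemma ray_zero_exists:
  assumes nbneg: "\<And>k. k \<in> nb \<Longrightarrow> \<tau> k = - 1"
    and z0: "\<And>j. j \<in> J \<Longrightarrow> lam j z0 \<le> - 5 * real (card J)" and F0: "F z0 > 0"
    and w: "w \<noteq> 0"
  obtains t where "t > 0" "z0 + t *\<^sub>R w \<in> ovals"
proof -
  define K where "K = {k \<in> nb. d k \<bullet> w > 0}"
  define T where "T = (\<lambda>k. (L - lam k z0) / (d k \<bullet> w))"
  have K: "finite K" "K \<noteq> {}" using spans_positive[OF w] fin_nb by (auto simp: K_def)
  have l0: "lam k z0 < L" if "k \<in> nb" for k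
    using z0[of k] that nb_sub L_bounds card_pos by (force simp: subset_iff)
  obtain k where k: "k \<in> K" "\<And>l. l \<in> K \<Longrightarrow> T k \<le> T l"
    using K by (metis arg_min_if_finite(1) arg_min_least)
  have Tk: "T k > 0" using k(1) l0 by (auto simp: K_def T_def)
  have reg: "z0 + t *\<^sub>R w \<in> region" if "0 \<le> t" "t \<le> T k" for t
  proof -
    have "lam l z0 + t * (d l \<bullet> w) \<le> L" if "l \<in> nb" for l
    proof (cases "l \<in> K")
      case True
      then have "t \<le> T l" using k(2) \<open>t \<le> T k\<close> by fastforce
      then show ?thesis using True by (simp add: T_def K_def pos_le_divide_eq)
    next
      case False
      then have "t * (d l \<bullet> w) \<le> 0" using \<open>0 \<le> t\<close> \<open>l \<in> nb\<close> by (auto simp: K_def mult_le_0_iff)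
      then show ?thesis using l0[OF \<open>l \<in> nb\<close>] by linarith
    qed
    then show ?thesis by (simp add: region_def lam_ray)
  qed
  have "lam k (z0 + T k *\<^sub>R w) = L" using k(1) by (simp add: lam_ray T_def K_def)
  then have "F (z0 + T k *\<^sub>R w) < 0"
    using boundary_neg[OF nbneg reg, of "T k" k] Tk k(1) by (auto simp: K_def)
  moreover have "continuous_on {0..T k} (\<lambda>t. F (z0 + t *\<^sub>R w))"
    by (intro continuous_on_compose2[OF F_continuous[of UNIV]] continuous_intros) auto
  ultimately obtain t where t: "0 \<le> t" "t \<le> T k" "F (z0 + t *\<^sub>R w) = 0"
    using IVT2'[of "\<lambda>t. F (z0 + t *\<^sub>R w)" "T k" 0 0] Tk F0 by auto
  moreover have "t \<noteq> 0" using t F0 by auto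
  ultimately show thesis using that[of t] reg[of t] ovals_eq[OF nbneg] by auto
qed

text \<open>Existence and uniqueness of the zero on each ray make the radial projection from a deep
  point a continuous bijection onto the unit circle.\<close>

lemma ovals_compact_connected:
  assumes nbneg: "\<And>k. k \<in> nb \<Longrightarrow> \<tau> k = - 1"
  shows "compact ovals" "connected ovals" "ovals \<noteq> {}"
proof -
  obtain z0 where z0: "\<And>j. j \<in> J \<Longrightarrow> lam j z0 \<le> - 5 * real (card J)"
    using deep_point by blast
  have F0: "F z0 > 0"
  proof -
    let ?n = "real (card J)"
    have "(\<Sum>j\<in>J. exp (lam j z0)) \<le> (\<Sum>j\<in>J. exp (- 5 * ?n))"
      by (rule sum_mono) (use z0 in auto)
    moreover have "5 * ?n * exp (- (5 * ?n)) \<le> 1" by (rule mult_exp_minus_le_one)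
    ultimately have "(\<Sum>j\<in>J. exp (lam j z0)) < 1" by simp
    then show ?thesis using abs_sum_tau[of J "\<lambda>j. exp (lam j z0)"] by (auto simp: F_def)
  qed
  have "closed {z. F z = 0}" by (rule closed_Collect_eq[OF F_continuous continuous_on_const])
  then show comp: "compact ovals"
    using region_compact closed_Int_compact by (simp add: ovals_eq[OF nbneg])
  have z0n: "z \<noteq> z0" if "z \<in> ovals" for z using that F0 by (auto simp: ovals_def)
  let ?f = "\<lambda>z. sgn (z - z0)"
  have cont: "continuous_on ovals ?f"
    unfolding sgn_div_norm using z0n by (intro continuous_intros) auto
  have ray: "z = z0 + norm (z - z0) *\<^sub>R sgn (z - z0)" for z
    by (cases "z = z0") (simp_all add: sgn_div_norm)
  have inj: "inj_on ?f ovals"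
  proof (rule inj_onI)
    fix x y assume xy: "x \<in> ovals" "y \<in> ovals" "?f x = ?f y"
    define w where "w = ?f x"
    have x: "x = z0 + norm (x - z0) *\<^sub>R w" and y: "y = z0 + norm (y - z0) *\<^sub>R w"
      using ray[of x] ray[of y] xy by (simp_all add: w_def)
    have "F x = 0" "F y = 0" "x \<in> region" "y \<in> region" using xy ovals_eq[OF nbneg] by auto
    moreover have "norm (x - z0) > 0" "norm (y - z0) > 0" using z0n xy by auto
    ultimately have "norm (x - z0) = norm (y - z0)"
      using ray_zero_unique[OF nbneg z0, of "norm (x - z0)" "norm (y - z0)" w]
        ray_zero_unique[OF nbneg z0, of "norm (y - z0)" "norm (x - z0)" w] x y
      by (cases "norm (x - z0)" "norm (y - z0)" rule: linorder_cases) auto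
    then show "x = y" using x y by simp
  qed
  have img: "?f ` ovals = sphere 0 1"
  proof
    show "?f ` ovals \<subseteq> sphere 0 1" using z0n by (auto simp: norm_sgn)
    show "sphere 0 1 \<subseteq> ?f ` ovals"
    proof
      fix w :: "real \<times> real" assume w: "w \<in> sphere 0 1"
      then have "norm w = 1" by simp
      then have "w \<noteq> 0" by auto
      then obtain t where t: "t > 0" "z0 + t *\<^sub>R w \<in> ovals"
        using ray_zero_exists[OF nbneg z0 F0] by blast
      have "?f (z0 + t *\<^sub>R w) = w" using t(1) \<open>norm w = 1\<close> by (simp add: sgn_div_norm)
      then show "w \<in> ?f ` ovals" using t(2) by (metis image_eqI)
    qed
  qed
  show "connected ovals"
    by (rule connected_if_inj_image_connected[OF comp cont inj])
      (simp add: img connected_sphere)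
  have "sphere (0 :: real \<times> real) 1 \<noteq> {}" by simp
  then show "ovals \<noteq> {}" using img by (metis image_is_empty)
qed

end

section \<open>The quadrants in which adjacent neighbours are never both negative\<close>

context star
begin

text \<open>Every index other than \<open>k\<close>, \<open>l\<close>, \<open>l'\<close> has a
  nonnegative coefficient at \<open>l\<close> in one triangle or at \<open>l'\<close> in the other,
  so its term is at most \<open>\<kappa>\<close>. Then \<open>F z = 0\<close> and
  \<open>exp (lam k z) < 1 + c\<close> squeeze the term of \<open>l'\<close>, while the term of
  \<open>l\<close> drops out of \<open>dF z \<theta>\<close>. The derivative is at most
  \<open>- 17/18 + (1/3 + 1/18) + 1/18\<close>.\<close>

lemma large_neighbour_estimates:
  assumes noadj: "\<And>k l. (k, l) \<in> E \<Longrightarrow> \<tau> k = - 1 \<Longrightarrow> \<tau> l = 1"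
    and kl: "(k, l) \<in> E" and k: "\<tau> k = - 1" "exp (lam k z) \<ge> 1 / (2 * real (card J))"
    and z: "z \<in> ovals" and \<theta>: "d k \<bullet> \<theta> = 1" "d l \<bullet> \<theta> = 0"
  shows "dF z \<theta> < 0" "exp (lam k z) > 1 / 2"
proof -
  let ?n = "real (card J)"
  obtain l' where l': "(k, l') \<in> E" "det2 (d k) (d l) * det2 (d k) (d l') < 0"
    using side[OF kl] by blast
  have "l \<noteq> l'" using l'(2) by (auto simp: mult_less_0_iff)
  have "k \<noteq> l" "k \<noteq> l'" using E_ne kl l' by auto
  have inJ: "k \<in> J" "l \<in> J" "l' \<in> J" using E_sub kl l' by auto
  have zL: "\<And>j. j \<in> J \<Longrightarrow> lam j z < L" and F0: "F z = 0" using z by (auto simp: ovals_def)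
  have lamc: "lam j z \<le> c" if "j \<in> J" for j using zL[OF that] L_bounds by simp
  have "exp (- lam k z) \<le> 2 * ?n"
    using k(2) card_pos by (simp add: exp_minus field_simps)
  then have lamk: "- lam k z \<le> 2 * ?n" using exp_ge_add_one_self[of "- lam k z"] by linarith
  \<comment> \<open>The coefficient at \<open>k\<close> can have either sign; for a negative one the
    lower bound on \<open>lam k z\<close> is used.\<close>
  have mk: "of_int m * lam k z \<le> real M * (2 * ?n + c)" if "\<bar>m\<bar> \<le> int M" for m :: int
  proof (cases "m \<ge> 0")
    case True
    moreover have "of_int m \<le> real M" using that by (intro of_int_le_real) simp
    ultimately show ?thesis using lamc[OF inJ(1)] c_pos card_pos
      by (intro lin_le) auto
  next
    case False
    have "of_int (- m) \<le> real M" using that by (intro of_int_le_real) simp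
    then have "of_int (- m) * (- lam k z) \<le> real M * (2 * ?n + c)"
      using False lamk c_pos card_pos by (intro lin_le) auto
    then show ?thesis by simp
  qed
  have rest: "exp (lam j z) \<le> \<kappa>" if j: "j \<in> J" "j \<notin> {k, l, l'}" for j
  proof -
    obtain m n where mn: "d j = of_int m *\<^sub>R d k + of_int n *\<^sub>R d l" "\<bar>m\<bar> \<le> int M" "\<bar>n\<bar> \<le> int M"
      using coords[OF kl j(1)] by blast
    have fin: "exp (lam j z) \<le> \<kappa>" if "lam j z \<le> of_int m' * lam k z + of_int n' * lam i z - \<Lambda>"
      "\<bar>m'\<bar> \<le> int M" "0 \<le> n'" "n' \<le> int M" "i \<in> J" for m' n' i
    proof -
      have "of_int n' * lam i z \<le> real M * c"
        using that lamc c_pos of_int_le_real by (intro lin_le) auto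
      then have "lam j z \<le> real M * (2 * ?n + 2 * c) - \<Lambda>"
        using that(1) mk[OF that(2)] unfolding distrib_left by linarith
      then show ?thesis by (simp add: \<kappa>_def)
    qed
    show ?thesis
    proof (cases "n \<ge> 0")
      case True
      then show ?thesis
        using fin[OF lam_rel[OF kl j(1) _ _ mn(1)]] j mn inJ by auto
    next
      case False
      \<comment> \<open>\<open>d l\<close> and \<open>d l'\<close> lie on opposite sides of the line
        spanned by \<open>d k\<close>, so a negative coefficient at \<open>l\<close> becomes a
        nonnegative one at \<open>l'\<close>.\<close>
      obtain m' n' where mn': "d j = of_int m' *\<^sub>R d k + of_int n' *\<^sub>R d l'" "\<bar>m'\<bar> \<le> int M" "\<bar>n'\<bar> \<le> int M"
        using coords[OF l'(1) j(1)] by blast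
      have "of_int n' * det2 (d k) (d l') = of_int n * det2 (d k) (d l)"
        using det2_lin(1)[of "d k" "of_int m'" "of_int n'" "d l'"]
          det2_lin(1)[of "d k" "of_int m" "of_int n" "d l"] mn mn' by simp
      then have "(of_int n' * of_int n) * (det2 (d k) (d l) * det2 (d k) (d l')) = (of_int n * det2 (d k) (d l)) ^ 2"
        by (simp add: power2_eq_square algebra_simps)
      also have "\<dots> \<ge> 0" by simp
      finally have "of_int n' * real_of_int n \<le> 0"
        using l'(2) by (smt (verit) mult_pos_neg)
      then have "n' \<ge> 0" using False by (auto simp: mult_le_0_iff)
      then show ?thesis
        using fin[OF lam_rel[OF l'(1) j(1) _ _ mn'(1)]] j mn' inJ by auto
    qed
  qed
  have split: "sum g J = g k + g l + g l' + sum g (J - {k, l, l'})" for g :: "nat \<Rightarrow> real"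
    using sum.subset_diff[of "{k, l, l'}" J g] fin inJ \<open>l \<noteq> l'\<close> \<open>k \<noteq> l\<close> \<open>k \<noteq> l'\<close> by auto
  have cardle: "real (card (J - {k, l, l'})) \<le> ?n" using card_mono[OF fin, of "J - {k, l, l'}"] by simp
  have "\<bar>\<Sum>j\<in>J - {k, l, l'}. \<tau> j * exp (lam j z)\<bar> \<le> (\<Sum>j\<in>J - {k, l, l'}. exp (lam j z))"
    by (rule abs_sum_tau) auto
  also have "\<dots> \<le> (\<Sum>j\<in>J - {k, l, l'}. \<kappa>)" by (rule sum_mono) (use rest in auto)
  also have "\<dots> \<le> ?n * \<kappa>" using kappa_pos cardle by (simp add: mult_right_mono)
  finally have rF: "\<bar>\<Sum>j\<in>J - {k, l, l'}. \<tau> j * exp (lam j z)\<bar> \<le> 1 / 18" using kappa_small(2) by linarith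
  have taul: "\<tau> l = 1" "\<tau> l' = 1" using noadj kl l' k by auto
  define r where "r = (\<Sum>j\<in>J - {k, l, l'}. \<tau> j * exp (lam j z))"
  have Feq: "0 = 1 - exp (lam k z) + exp (lam l z) + exp (lam l' z) + r"
    using F0 split[of "\<lambda>j. \<tau> j * exp (lam j z)"] taul k by (simp add: F_def r_def)
  have r: "\<bar>r\<bar> \<le> ?n * \<kappa>"
    using \<open>(\<Sum>j\<in>J - {k, l, l'}. \<kappa>) \<le> ?n * \<kappa>\<close> \<open>(\<Sum>j\<in>J - {k, l, l'}. exp (lam j z)) \<le> (\<Sum>j\<in>J - {k, l, l'}. \<kappa>)\<close>
      \<open>\<bar>\<Sum>j\<in>J - {k, l, l'}. \<tau> j * exp (lam j z)\<bar> \<le> (\<Sum>j\<in>J - {k, l, l'}. exp (lam j z))\<close>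
    unfolding r_def by linarith
  have ek: "exp (lam k z) < 1 + c" using zL[OF inJ(1)] L_bounds(3) by (metis exp_less_mono)
  have lpos: "exp (lam l z) > 0" "exp (lam l' z) > 0" by auto
  have el': "exp (lam l' z) \<le> c + ?n * \<kappa>" using Feq r ek lpos by linarith
  have ek2: "exp (lam k z) \<ge> 17 / 18" using Feq rF lpos unfolding r_def by linarith
  then show "exp (lam k z) > 1 / 2" by simp
  have dth: "\<bar>d j \<bullet> \<theta>\<bar> \<le> real M" if j: "j \<in> J" for j
  proof -
    obtain m n where mn: "d j = of_int m *\<^sub>R d k + of_int n *\<^sub>R d l" "\<bar>m\<bar> \<le> int M"
      using coords[OF kl j] by blast
    have "real_of_int \<bar>m\<bar> \<le> real M" using mn(2) by (rule of_int_le_real)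
    then show ?thesis using \<theta> mn(1) by (simp add: inner_add_left)
  qed
  have "\<bar>\<Sum>j\<in>J - {k, l, l'}. \<tau> j * (d j \<bullet> \<theta>) * exp (lam j z)\<bar> \<le> (\<Sum>j\<in>J - {k, l, l'}. real M * \<kappa>)"
  proof (rule order.trans[OF sum_abs sum_mono])
    fix j assume "j \<in> J - {k, l, l'}"
    then show "\<bar>\<tau> j * (d j \<bullet> \<theta>) * exp (lam j z)\<bar> \<le> real M * \<kappa>"
      using dth[of j] rest[of j] by (auto simp: abs_mult tau intro!: mult_mono)
  qed
  also have "\<dots> \<le> ?n * (real M * \<kappa>)"
    unfolding sum_constant using kappa_pos cardle by (intro mult_right_mono) auto
  finally have rdF: "\<bar>\<Sum>j\<in>J - {k, l, l'}. \<tau> j * (d j \<bullet> \<theta>) * exp (lam j z)\<bar> \<le> 1 / 18"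
    using kappa_small(1) by (simp add: mult.assoc)
  have "(d l' \<bullet> \<theta>) * exp (lam l' z) \<le> real M * (c + ?n * \<kappa>)"
    using dth[OF inJ(3)] el' by (intro mult_mono) auto
  also have "\<dots> \<le> 1 / 3 + 1 / 18"
    using Mc kappa_small(1) unfolding distrib_left by (simp add: mult_ac)
  finally have "(d l' \<bullet> \<theta>) * exp (lam l' z) \<le> 1 / 3 + 1 / 18" .
  moreover have "dF z \<theta> = - exp (lam k z) + (d l' \<bullet> \<theta>) * exp (lam l' z)
      + (\<Sum>j\<in>J - {k, l, l'}. \<tau> j * (d j \<bullet> \<theta>) * exp (lam j z))"
    unfolding dF_def split[of "\<lambda>j. \<tau> j * (d j \<bullet> \<theta>) * exp (lam j z)"] using \<theta> taul k by simp
  ultimately show "dF z \<theta> < 0" using ek2 rdF by linarith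
qed

lemma dual_basis:
  assumes "det2 u v \<noteq> 0"
  obtains \<theta> where "u \<bullet> \<theta> = 1" "v \<bullet> \<theta> = (0::real)"
proof
  let ?t = "(snd v / det2 u v, - fst v / det2 u v)"
  have "fst u * snd v - snd u * fst v \<noteq> 0" using assms by (simp add: det2_def)
  then show "u \<bullet> ?t = 1"
    by (simp add: inner_prod_def det2_def diff_divide_distrib[symmetric])
  show "v \<bullet> ?t = 0" by (simp add: inner_prod_def)
qed

text \<open>On the part of \<open>W\<close> where one fixed negative neighbour \<open>k\<close> is
  large, take a point with \<open>lam l\<close> maximal. Through it runs an arc of zeros along which
  \<open>lam l\<close> increases, and by maximality \<open>W\<close> contains this arc. The
  assumption \<open>maximal\<close> is the only trace of \<open>W\<close> being a component.\<close>

lemma no_trapped_component: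
  assumes noadj: "\<And>k l. (k, l) \<in> E \<Longrightarrow> \<tau> k = - 1 \<Longrightarrow> \<tau> l = 1"
    and W: "closed W" "W \<noteq> {}" "W \<subseteq> ovals"
    and maximal: "\<And>S. connected S \<Longrightarrow> S \<subseteq> {z. F z = 0} \<Longrightarrow> S \<inter> W \<noteq> {} \<Longrightarrow> S \<subseteq> W"
  shows False
proof -
  let ?n = "real (card J)"
  have reg: "W \<subseteq> region" using W(3) nb_sub by (force simp: ovals_def region_def)
  obtain z1 where z1: "z1 \<in> W" using W(2) by blast
  then have "F z1 = 0" "z1 \<in> region" using W(3) reg by (auto simp: ovals_def)
  \<comment> \<open>Dropping the positive terms shows that the negative neighbours must balance the
    constant term 1.\<close>
  have "(\<Sum>k\<in>nb. \<tau> k * exp (lam k z1)) \<ge> - (\<Sum>k\<in>{k \<in> nb. \<tau> k = - 1}. exp (lam k z1))"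
  proof -
    have "(\<Sum>k\<in>nb. \<tau> k * exp (lam k z1)) \<ge> (\<Sum>k\<in>nb. if \<tau> k = - 1 then - exp (lam k z1) else 0)"
    proof (rule sum_mono)
      fix k assume "k \<in> nb"
      then have "\<tau> k = 1 \<or> \<tau> k = - 1" using tau[of k] nb_sub by (auto simp: abs_if split: if_splits)
      then show "(if \<tau> k = - 1 then - exp (lam k z1) else 0) \<le> \<tau> k * exp (lam k z1)" by auto
    qed
    then show ?thesis
      using sum.inter_filter[OF fin_nb, of "\<lambda>k. - exp (lam k z1)" "\<lambda>k. \<tau> k = - 1"] by (simp add: sum_negf)
  qed
  then have "1 / 2 \<le> (\<Sum>k\<in>{k \<in> nb. \<tau> k = - 1}. exp (lam k z1))"
    using \<open>F z1 = 0\<close> F_split[of z1] sum_far_abs[OF \<open>z1 \<in> region\<close>] kappa_small(2) by linarith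
  moreover have "card {k \<in> nb. \<tau> k = - 1} \<le> card J" using fin nb_sub by (intro card_mono) auto
  ultimately obtain k where k: "k \<in> nb" "\<tau> k = - 1" "1 / 2 / ?n \<le> exp (lam k z1)"
    using exists_ge_average[of "{k \<in> nb. \<tau> k = - 1}" "1 / 2" "\<lambda>k. exp (lam k z1)" "card J"] fin_nb by auto
  obtain l where kl: "(k, l) \<in> E" using k(1) by (auto simp: nb_def)
  obtain \<theta> where \<theta>: "d k \<bullet> \<theta> = 1" "d l \<bullet> \<theta> = 0" using dual_basis[OF E_det[OF kl]] by blast
  obtain \<psi> where \<psi>: "d l \<bullet> \<psi> = 1" "d k \<bullet> \<psi> = 0" using dual_basis[OF E_det[OF E_sym[OF kl]]] by blast
  \<comment> \<open>The threshold makes the set closed, and the estimates improve it to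
    \<open>exp (lam k z) > 1 / 2\<close>, so the maximum is never attained on the artificial
    boundary.\<close>
  define K where "K = W \<inter> {z. 1 / (2 * ?n) \<le> exp (lam k z)}"
  have "closed {z. 1 / (2 * ?n) \<le> exp (lam k z)}"
    by (intro closed_Collect_le continuous_intros lam_continuous)
  then have "closed K" unfolding K_def by (rule closed_Int[OF W(1)])
  then have "compact (region \<inter> K)" by (rule compact_Int_closed[OF region_compact])
  moreover have "region \<inter> K = K" using reg by (auto simp: K_def)
  ultimately have "compact K" by simp
  moreover have "z1 \<in> K" using z1 k by (simp add: K_def)
  ultimately obtain z where z: "z \<in> K" "\<And>y. y \<in> K \<Longrightarrow> lam l y \<le> lam l z"
    using continuous_attains_sup[of K "lam l"] lam_continuous by (metis empty_iff)
  have zo: "z \<in> ovals" using z W by (auto simp: K_def)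
  have est: "dF z \<theta> < 0" "exp (lam k z) > 1 / 2"
    using large_neighbour_estimates[OF noadj kl k(2) _ zo \<theta>] z(1) by (auto simp: K_def)
  have "1 / (2 * ?n) \<le> 1 / 2" using card_pos by (simp add: field_simps)
  then have gap: "exp (lam k z) > 1 / (2 * ?n)" using est by linarith
  \<comment> \<open>Changing \<open>lam k\<close> by at most \<open>e\<close> cannot bring it below
    the threshold, so an arc through \<open>z\<close> this short stays in \<open>K\<close>.\<close>
  define e where "e = lam k z - ln (1 / (2 * ?n))"
  have "exp (ln (1 / (2 * ?n))) < exp (lam k z)" using gap card_pos by (subst exp_ln) auto
  then have e: "e > 0" by (simp only: exp_less_cancel_iff e_def diff_gt_0_iff_gt)
  define p where "p = (\<lambda>x. z + (fst x *\<^sub>R \<theta> + snd x *\<^sub>R \<psi>))"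
  have pc: "continuous_on A p" for A unfolding p_def by (intro continuous_intros)
  have lp: "lam k (p x) = lam k z + fst x" "lam l (p x) = lam l z + snd x" for x
    using \<theta> \<psi> by (auto simp: p_def lam_def inner_add_right)
  obtain S where S: "connected S" "S \<subseteq> {x. F (p (fst x, snd x)) = 0 \<and> \<bar>fst x\<bar> \<le> e \<and> \<bar>snd x\<bar> \<le> e}"
    "(0, 0) \<in> S" "\<exists>x\<in>S. snd x > 0"
  proof (rule zero_curve_ascends[of "\<lambda>s t. F (p (s, t))" "\<lambda>s t. dF (p (s, t)) \<theta>" e])
    show "continuous_on UNIV (\<lambda>z. F (p (fst z, snd z)))"
      by (intro continuous_on_compose2[OF F_continuous[of UNIV]] continuous_on_compose2[OF pc[of UNIV]] continuous_intros) auto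
    show "continuous_on UNIV (\<lambda>z. dF (p (fst z, snd z)) \<theta>)"
      by (intro continuous_on_compose2[OF dF_continuous[of UNIV]] continuous_on_compose2[OF pc[of UNIV]] continuous_intros) auto
    show "((\<lambda>s. F (p (s, t))) has_real_derivative dF (p (s, t)) \<theta>) (at s)" for s t
      using F_deriv[of "z + t *\<^sub>R \<psi>" \<theta> s] by (simp add: p_def add_ac)
  qed (use e est zo in \<open>auto simp: p_def ovals_def\<close>)
  have "p ` S \<subseteq> W"
  proof (rule maximal)
    show "connected (p ` S)" using S(1) pc connected_continuous_image by blast
    show "p ` S \<subseteq> {z. F z = 0}" using S(2) by auto
    have "p (0, 0) = z" by (simp add: p_def)
    then show "p ` S \<inter> W \<noteq> {}" using S(3) z(1) by (force simp: K_def)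
  qed
  moreover obtain x where x: "x \<in> S" "snd x > 0" using S(4) by blast
  ultimately have "p x \<in> W" by blast
  moreover have "exp (lam k (p x)) \<ge> 1 / (2 * ?n)"
  proof -
    have "lam k (p x) \<ge> ln (1 / (2 * ?n))" using S(2) x(1) by (auto simp: lp e_def abs_le_iff)
    then have "exp (lam k (p x)) \<ge> exp (ln (1 / (2 * ?n)))" by simp
    then show ?thesis using card_pos by (subst (asm) exp_ln) auto
  qed
  ultimately have "lam l (p x) \<le> lam l z" using z(2) by (simp add: K_def)
  then show False using x(2) by (simp add: lp)
qed

end

lemma det2_pt:
  "det2 (pt b j - pt b i) (pt b k - pt b i) =
    of_int ((fst (b j) - fst (b i)) * (snd (b k) - snd (b i)) - (snd (b j) - snd (b i)) * (fst (b k) - fst (b i)))"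
  by (simp add: det2_def pt_def)

section \<open>The triangles at an interior lattice point\<close>

locale unimodular_polygon =
  fixes P :: "(real \<times> real) set" and b :: "nat \<Rightarrow> int \<times> int" and N :: nat and T :: "nat set set"
  assumes b_inj: "inj_on b {1..N}"
    and triang: "unimodular_triangulation P b N T"
begin

lemma T_sub: "\<sigma> \<in> T \<Longrightarrow> \<sigma> \<subseteq> {1..N}"
  using triang by (auto simp: unimodular_triangulation_def)

lemma T_triple:
  assumes "\<sigma> \<in> T"
  obtains i j k where "\<sigma> = {i, j, k}" "\<bar>det2 (pt b j - pt b i) (pt b k - pt b i)\<bar> = 1"
proof -
  have "\<forall>\<sigma>\<in>T. \<exists>i j k. \<sigma> = {i, j, k} \<and> \<bar>det2 (pt b j - pt b i) (pt b k - pt b i)\<bar> = 1"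
    using triang unfolding unimodular_triangulation_def by (elim conjE) assumption
  from bspec[OF this assms] show thesis by (elim exE conjE) (rule that)
qed

text \<open>The definition provides some ordering of the vertices; all six orderings give the same
  determinant up to sign.\<close>

lemma tri_det:
  assumes "{i, k, l} \<in> T"
  shows "\<bar>det2 (pt b k - pt b i) (pt b l - pt b i)\<bar> = 1"
proof -
  obtain x y z where eq: "{i, k, l} = {x, y, z}" and D: "\<bar>det2 (pt b y - pt b x) (pt b z - pt b x)\<bar> = 1"
    by (rule T_triple[OF assms])
  have "x \<noteq> y" "x \<noteq> z" "y \<noteq> z" using D by (auto simp: det2_def)
  then have "i = x \<and> k = y \<and> l = z \<or> i = x \<and> k = z \<and> l = y \<or> i = y \<and> k = x \<and> l = z \<or>
    i = y \<and> k = z \<and> l = x \<or> i = z \<and> k = x \<and> l = y \<or> i = z \<and> k = y \<and> l = x"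
    using eq by (metis insert_iff singletonD)
  then show ?thesis
  proof (elim disjE conjE)
  qed (use D in \<open>simp_all add: det2_def algebra_simps abs_eq_iff\<close>)
qed

lemma T_vertex:
  assumes "\<sigma> \<in> T" "i \<in> \<sigma>"
  obtains k l where "\<sigma> = {i, k, l}"
proof -
  obtain x y z where eq: "\<sigma> = {x, y, z}" by (rule T_triple[OF assms(1)])
  then consider "i = x" | "i = y" | "i = z" using assms(2) by auto
  then show thesis
  proof cases
    case 1 then show thesis using eq that[of y z] by simp
  next
    case 2 then show thesis using eq that[of x z] by (simp add: insert_commute)
  next
    case 3 then show thesis using eq that[of x y] by (simp add: insert_commute)
  qed
qed

end

text \<open>A second locale, because deriving \<open>coord_bound\<close> from a bound on flags
  already relies on \<open>tri_det\<close>.\<close>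

locale triangulated_polygon = unimodular_polygon +
  fixes M :: nat
  assumes coord_bound: "{i, k, l} \<in> T \<Longrightarrow> j \<in> {1..N} \<Longrightarrow>
      pt b j - pt b i = of_int m *\<^sub>R (pt b k - pt b i) + of_int n *\<^sub>R (pt b l - pt b i) \<Longrightarrow>
      \<bar>m\<bar> \<le> int M \<and> \<bar>n\<bar> \<le> int M"
begin

lemma tri_coords:
  assumes "{i, k, l} \<in> T" "j \<in> {1..N}"
  obtains m n :: int where
    "pt b j - pt b i = of_int m *\<^sub>R (pt b k - pt b i) + of_int n *\<^sub>R (pt b l - pt b i)"
    "\<bar>m\<bar> \<le> int M" "\<bar>n\<bar> \<le> int M"
proof -
  let ?D = "\<lambda>j k. (fst (b j) - fst (b i)) * (snd (b k) - snd (b i)) - (snd (b j) - snd (b i)) * (fst (b k) - fst (b i))"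
  \<comment> \<open>Cramer's rule: the determinant of the basis is 1 or -1, so multiplying by it
    replaces dividing.\<close>
  define m n where "m = ?D j l * ?D k l" and "n = ?D k j * ?D k l"
  have "\<bar>?D k l\<bar> = 1" using tri_det[OF assms(1)] unfolding det2_pt by linarith
  then have "?D k l * ?D k l = 1" by (metis abs_mult_self_eq mult_1)
  then have "fst (b j) - fst (b i) = m * (fst (b k) - fst (b i)) + n * (fst (b l) - fst (b i))"
    "snd (b j) - snd (b i) = m * (snd (b k) - snd (b i)) + n * (snd (b l) - snd (b i))"
    unfolding m_def n_def by (algebra, algebra)
  then have "real_of_int (fst (b j) - fst (b i)) = real_of_int (m * (fst (b k) - fst (b i)) + n * (fst (b l) - fst (b i)))"
    "real_of_int (snd (b j) - snd (b i)) = real_of_int (m * (snd (b k) - snd (b i)) + n * (snd (b l) - snd (b i)))"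
    by (simp_all only:)
  then have "pt b j - pt b i = of_int m *\<^sub>R (pt b k - pt b i) + of_int n *\<^sub>R (pt b l - pt b i)"
    by (simp add: pt_def prod_eq_iff)
  then show thesis using that coord_bound[OF assms] by blast
qed

lemma tri_coords_unique:
  assumes "{i, k, l} \<in> T"
    "m *\<^sub>R (pt b k - pt b i) + n *\<^sub>R (pt b l - pt b i) = m' *\<^sub>R (pt b k - pt b i) + n' *\<^sub>R (pt b l - pt b i)"
  shows "m = m'" "n = n'"
proof -
  let ?u = "pt b k - pt b i" and ?v = "pt b l - pt b i"
  have "det2 ?u ?v \<noteq> 0" using tri_det[OF assms(1)] by auto
  then show "m = m'" "n = n'"
    using det2_lin(1)[of ?u m n ?v] det2_lin(1)[of ?u m' n' ?v]
      det2_lin(2)[of m ?u n ?v] det2_lin(2)[of m' ?u n' ?v] assms(2) by auto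
qed

lemma pt_eq_iff: "i \<in> {1..N} \<Longrightarrow> j \<in> {1..N} \<Longrightarrow> pt b i = pt b j \<longleftrightarrow> i = j"
  using inj_on_eq_iff[OF b_inj] by (simp add: pt_def prod_eq_iff)

text \<open>A lattice point of a unimodular triangle has integer barycentric coordinates. Being
  nonnegative with sum 1, they single out a vertex.\<close>

lemma pt_notin_triangle:
  assumes "\<sigma> \<in> T" "i \<in> {1..N}" "i \<notin> \<sigma>"
  shows "pt b i \<notin> convex hull (pt b ` \<sigma>)"
proof
  assume "pt b i \<in> convex hull (pt b ` \<sigma>)"
  moreover obtain j k l where \<sigma>: "\<sigma> = {j, k, l}" by (rule T_triple[OF assms(1)])
  ultimately obtain u v w where uvw: "u \<ge> 0" "v \<ge> 0" "w \<ge> 0" "u + v + w = 1"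
    "pt b i = u *\<^sub>R pt b j + v *\<^sub>R pt b k + w *\<^sub>R pt b l"
    by (auto simp: convex_hull_3)
  have u: "u = 1 - v - w" using uvw by simp
  have "pt b i - pt b j = v *\<^sub>R (pt b k - pt b j) + w *\<^sub>R (pt b l - pt b j)"
    unfolding uvw(5) u by (simp add: algebra_simps)
  moreover obtain m n :: int where
    "pt b i - pt b j = of_int m *\<^sub>R (pt b k - pt b j) + of_int n *\<^sub>R (pt b l - pt b j)"
    using tri_coords[of j k l i] assms \<sigma> by blast
  ultimately have "v = of_int m" "w = of_int n"
    using tri_coords_unique[of j k l v w "of_int m" "of_int n"] assms(1) \<sigma> by metis+
  then have "m \<ge> 0" "n \<ge> 0" "m + n \<le> 1" using uvw by (auto simp flip: of_int_add)
  then have "m = 0 \<and> n = 0 \<or> m = 1 \<and> n = 0 \<or> m = 0 \<and> n = 1" by linarith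
  then have "pt b i = pt b j \<or> pt b i = pt b k \<or> pt b i = pt b l"
    using uvw \<open>v = of_int m\<close> \<open>w = of_int n\<close> by auto
  moreover have "j \<in> {1..N}" "k \<in> {1..N}" "l \<in> {1..N}" using T_sub[OF assms(1)] \<sigma> by auto
  ultimately have "i = j \<or> i = k \<or> i = l" using pt_eq_iff[OF assms(2)] by metis
  then show False using assms(3) \<sigma> by simp
qed

text \<open>The triangles that avoid \<open>i\<close> form a closed set not containing the point, so
  a short step in any direction stays in a triangle with vertex \<open>i\<close>. Rescaling the step
  gives the cone coordinates.\<close>

lemma interior_cone:
  assumes i: "i \<in> {1..N}" "pt b i \<in> interior P"
  obtains k l m n where "{i, k, l} \<in> T" "m \<ge> 0" "n \<ge> 0"
    "w = m *\<^sub>R (pt b k - pt b i) + n *\<^sub>R (pt b l - pt b i)"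
proof -
  define U where "U = (\<Union>\<sigma>\<in>{\<sigma> \<in> T. i \<notin> \<sigma>}. convex hull (pt b ` \<sigma>))"
  have "finite T" and PT: "P = (\<Union>\<sigma>\<in>T. convex hull (pt b ` \<sigma>))"
    using triang by (auto simp: unimodular_triangulation_def)
  have "closed U" unfolding U_def
  proof (intro closed_UN ballI)
    fix \<sigma> assume "\<sigma> \<in> {\<sigma> \<in> T. i \<notin> \<sigma>}"
    then have "finite \<sigma>" using T_sub finite_subset by blast
    then show "closed (convex hull (pt b ` \<sigma>))"
      by (intro compact_imp_closed finite_imp_compact_convex_hull) auto
  qed (use \<open>finite T\<close> in auto)
  then have "open (interior P - U)" by (simp add: open_Diff)
  moreover have "pt b i \<in> interior P - U" using i pt_notin_triangle by (auto simp: U_def)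
  ultimately obtain e where e: "e > 0" "ball (pt b i) e \<subseteq> interior P - U"
    by (rule openE)
  \<comment> \<open>Adding 1 to the norm also covers \<open>w = 0\<close>.\<close>
  define t where "t = e / 2 / (norm w + 1)"
  have t: "t > 0" unfolding t_def using e norm_ge_zero[of w] by (intro divide_pos_pos) linarith+
  have "t * norm w < e"
  proof -
    have "t * norm w \<le> t * (norm w + 1)" using t by simp
    also have "\<dots> = e / 2"
    proof -
      have "norm w + 1 \<noteq> 0" using norm_ge_zero[of w] by linarith
      then show ?thesis unfolding t_def by (rule nonzero_eq_divide_eq[THEN iffD1, OF _ refl])
    qed
    finally show ?thesis using e by simp
  qed
  then have "pt b i + t *\<^sub>R w \<in> ball (pt b i) e" using t by (simp add: dist_norm)
  then have "pt b i + t *\<^sub>R w \<in> interior P - U" using e(2) by blast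
  then have x: "pt b i + t *\<^sub>R w \<in> P" "pt b i + t *\<^sub>R w \<notin> U" using interior_subset[of P] by auto
  then obtain \<sigma> where \<sigma>: "\<sigma> \<in> T" "pt b i + t *\<^sub>R w \<in> convex hull (pt b ` \<sigma>)" using PT by blast
  then have "i \<in> \<sigma>" using x(2) by (auto simp: U_def)
  then obtain k l where kl: "\<sigma> = {i, k, l}" by (rule T_vertex[OF \<sigma>(1)])
  obtain u v r where uvr: "u \<ge> 0" "v \<ge> 0" "r \<ge> 0" "u + v + r = 1"
    "pt b i + t *\<^sub>R w = u *\<^sub>R pt b i + v *\<^sub>R pt b k + r *\<^sub>R pt b l"
    using \<sigma>(2) kl by (auto simp: convex_hull_3)
  have u: "u = 1 - v - r" using uvr by simp
  have "t *\<^sub>R w = v *\<^sub>R (pt b k - pt b i) + r *\<^sub>R (pt b l - pt b i)"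
    using uvr(5) unfolding u by (simp add: algebra_simps)
  then have "w = (v / t) *\<^sub>R (pt b k - pt b i) + (r / t) *\<^sub>R (pt b l - pt b i)"
  proof -
    have "w = (1 / t) *\<^sub>R (t *\<^sub>R w)" using t by simp
    also have "\<dots> = (1 / t) *\<^sub>R (v *\<^sub>R (pt b k - pt b i) + r *\<^sub>R (pt b l - pt b i))"
      using \<open>t *\<^sub>R w = _\<close> by (rule arg_cong)
    finally show ?thesis by (simp add: scaleR_add_right)
  qed
  moreover have "v / t \<ge> 0" "r / t \<ge> 0" using uvr t by simp_all
  moreover have "{i, k, l} \<in> T" using \<sigma>(1) kl by simp
  ultimately show thesis using that by blast
qed

text \<open>A point on the edge from \<open>i\<close> to \<open>k\<close>, close to
  \<open>i\<close>, lies in both triangles and hence in the hull of their common vertices. If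
  \<open>k\<close> were not common, it would lie on the line through \<open>i\<close> and
  \<open>l\<close>.\<close>

lemma common_edge:
  assumes kl: "{i, k, l} \<in> T" and kl': "{i, k', l'} \<in> T" and ab: "\<alpha> \<ge> 0" "\<beta> \<ge> 0"
    and eq: "pt b k - pt b i = \<alpha> *\<^sub>R (pt b k' - pt b i) + \<beta> *\<^sub>R (pt b l' - pt b i)"
  shows "k = k' \<or> k = l'"
proof (rule ccontr)
  assume neg: "\<not> (k = k' \<or> k = l')"
  \<comment> \<open>Chosen so that the barycentric coordinate at \<open>i\<close> in the second
    triangle, \<open>1 - s * \<alpha> - s * \<beta>\<close>, is again \<open>s\<close>.\<close>
  define s where "s = 1 / (\<alpha> + \<beta> + 1)"
  have s: "0 < s" "s \<le> 1" "s * \<alpha> + s * \<beta> + s = 1"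
    using ab by (auto simp: s_def simp flip: add_divide_distrib)
  define x where "x = pt b i + s *\<^sub>R (pt b k - pt b i)"
  have "x = (1 - s) *\<^sub>R pt b i + s *\<^sub>R pt b k + 0 *\<^sub>R pt b l"
    by (simp add: x_def algebra_simps)
  then have "x \<in> convex hull {pt b i, pt b k, pt b l}"
    unfolding convex_hull_3 using s by (intro CollectI exI[of _ "1 - s"] exI[of _ s] exI[of _ 0]) simp
  moreover have "x = s *\<^sub>R pt b i + (s * \<alpha>) *\<^sub>R pt b k' + (s * \<beta>) *\<^sub>R pt b l'"
  proof -
    have "s *\<^sub>R pt b i = (1 - s * \<alpha> - s * \<beta>) *\<^sub>R pt b i" using s(3) by (metis add_diff_cancel_left' diff_diff_eq)
    then show ?thesis unfolding x_def eq by (simp add: algebra_simps)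
  qed
  then have "x \<in> convex hull {pt b i, pt b k', pt b l'}"
    unfolding convex_hull_3 using s ab
    by (intro CollectI exI[of _ s] exI[of _ "s * \<alpha>"] exI[of _ "s * \<beta>"]) simp
  ultimately have "x \<in> convex hull (pt b ` {i, k, l}) \<inter> convex hull (pt b ` {i, k', l'})" by simp
  also have "\<dots> = convex hull (pt b ` ({i, k, l} \<inter> {i, k', l'}))"
    using triang kl kl' unfolding unimodular_triangulation_def by blast
  also have "\<dots> \<subseteq> convex hull {pt b i, pt b l}"
    by (rule hull_mono) (use neg in auto)
  finally obtain u v where "x = u *\<^sub>R pt b i + v *\<^sub>R pt b l" "u + v = 1"
    by (auto simp: convex_hull_2)
  then have "u = 1 - v" and "x = u *\<^sub>R pt b i + v *\<^sub>R pt b l" by auto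
  then have "s *\<^sub>R (pt b k - pt b i) + 0 *\<^sub>R (pt b l - pt b i) = 0 *\<^sub>R (pt b k - pt b i) + v *\<^sub>R (pt b l - pt b i)"
    unfolding x_def \<open>u = 1 - v\<close> by (simp add: algebra_simps)
  from tri_coords_unique(1)[OF kl this] show False using s by simp
qed

text \<open>The cones at an interior point fill the plane, so directions just across the edge to
  \<open>k\<close> are covered too; the triangle covering them must share that edge.\<close>

lemma opposite_triangle:
  assumes i: "i \<in> {1..N}" "pt b i \<in> interior P" and kl: "{i, k, l} \<in> T"
  obtains l' where "{i, k, l'} \<in> T"
    "det2 (pt b k - pt b i) (pt b l - pt b i) * det2 (pt b k - pt b i) (pt b l' - pt b i) < 0"
proof -
  note that0 = that
  let ?d = "\<lambda>j. pt b j - pt b i"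
  let ?K = "real M + 1"
  have kN: "k \<in> {1..N}" "l \<in> {1..N}" using T_sub[OF kl] by auto
  \<comment> \<open>A triangle whose cone contains a vector so close to the ray of \<open>k\<close>, on the side away from \<open>l\<close>,
    that its cone contains \<open>k\<close> itself, because all coordinates are integers bounded by \<open>M\<close>.\<close>
  obtain k' l' m n where kl': "{i, k', l'} \<in> T" and mn: "m \<ge> 0" "n \<ge> 0"
    and eq: "?K *\<^sub>R ?d k + (- 1) *\<^sub>R ?d l = m *\<^sub>R ?d k' + n *\<^sub>R ?d l'"
    using interior_cone[OF i] by metis
  obtain \<alpha> \<beta> where ab: "?d k = of_int \<alpha> *\<^sub>R ?d k' + of_int \<beta> *\<^sub>R ?d l'"
    using tri_coords[OF kl' kN(1)] by blast
  obtain \<gamma> \<delta> where gd: "?d l = of_int \<gamma> *\<^sub>R ?d k' + of_int \<delta> *\<^sub>R ?d l'" "\<bar>\<gamma>\<bar> \<le> int M" "\<bar>\<delta>\<bar> \<le> int M"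
    using tri_coords[OF kl' kN(2)] by blast
  have "(?K * of_int \<alpha> - of_int \<gamma>) *\<^sub>R ?d k' + (?K * of_int \<beta> - of_int \<delta>) *\<^sub>R ?d l' = m *\<^sub>R ?d k' + n *\<^sub>R ?d l'"
    unfolding eq[symmetric] ab gd(1) by (simp only: scaleR_diff_left scaleR_add_right scaleR_scaleR) (simp add: algebra_simps)
  from tri_coords_unique[OF kl' this]
  have "?K * of_int \<alpha> - of_int \<gamma> \<ge> 0" "?K * of_int \<beta> - of_int \<delta> \<ge> 0" using mn by auto
  then have "real_of_int ((int M + 1) * \<alpha>) \<ge> of_int \<gamma>" "real_of_int ((int M + 1) * \<beta>) \<ge> of_int \<delta>" by simp_all
  then have le: "(int M + 1) * \<alpha> \<ge> \<gamma>" "(int M + 1) * \<beta> \<ge> \<delta>" by linarith+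
  \<comment> \<open>Integrality enters here: a negative integer \<open>x\<close> would give
    \<open>(M + 1) * x \<le> - (M + 1) < y\<close>.\<close>
  have nonneg: "x \<ge> 0" if "(int M + 1) * x \<ge> y" "\<bar>y\<bar> \<le> int M" for x y :: int
  proof (rule ccontr)
    assume "\<not> x \<ge> 0"
    then have "(int M + 1) * x \<le> - (int M + 1)" using mult_left_mono[of x "- 1" "int M + 1"] by simp
    then show False using that by linarith
  qed
  have "\<alpha> \<ge> 0" "\<beta> \<ge> 0" using nonneg le gd by blast+
  then have k: "k = k' \<or> k = l'" using common_edge[OF kl kl' _ _ ab] by simp
  have main: thesis if "{i, k, l''} \<in> T" "n' \<ge> 0" "?K *\<^sub>R ?d k + (- 1) *\<^sub>R ?d l = m' *\<^sub>R ?d k + n' *\<^sub>R ?d l''" for l'' m' n'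
  proof -
    let ?e = "det2 (?d k) (?d l)" and ?e' = "det2 (?d k) (?d l'')"
    have e: "- ?e = n' * ?e'"
      using det2_lin(1)[of "?d k" ?K "-1" "?d l"] det2_lin(1)[of "?d k" m' n' "?d l''"] that(3) by simp
    have sq: "?e'\<^sup>2 = 1" using tri_det[OF that(1)] by (metis power2_abs power_one)
    have "?e \<noteq> 0" using tri_det[OF kl] by auto
    then have "n' \<noteq> 0" using e by auto
    have "?e * ?e' = - n' * ?e'\<^sup>2" using e by algebra
    also have "\<dots> < 0" using that(2) \<open>n' \<noteq> 0\<close> by (simp add: sq)
    finally show thesis using that0 that(1) by blast
  qed
  from k show thesis
  proof
    assume "k = k'"
    then show thesis using main[of l' n m] kl' mn eq by blast
  next
    assume "k = l'"
    moreover have "{i, l', k'} \<in> T" using kl' by (simp add: insert_commute)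
    ultimately show thesis using main[of k' m n] mn eq by (simp add: add.commute)
  qed
qed

text \<open>Equal parities would make both entries of the edge vector even, and then the determinant
  too.\<close>

lemma adjacent_parity:
  assumes "{i, k, l} \<in> T"
  shows "(odd (fst (b k)), odd (snd (b k))) \<noteq> (odd (fst (b i)), odd (snd (b i)))"
proof
  let ?D = "(fst (b k) - fst (b i)) * (snd (b l) - snd (b i)) - (snd (b k) - snd (b i)) * (fst (b l) - fst (b i))"
  assume "(odd (fst (b k)), odd (snd (b k))) = (odd (fst (b i)), odd (snd (b i)))"
  then have "even ?D" by simp
  moreover have "\<bar>?D\<bar> = 1" using tri_det[OF assms] unfolding det2_pt by linarith
  ultimately show False by (metis abs_1 even_abs_add_iff odd_one even_add)
qed

end

section \<open>Coefficients in the basis of a triangle\<close>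

text \<open>Fewer equations than unknowns: by induction on the equations, one of them is solved for
  a pivot unknown \<open>k0\<close> and substituted into the others.\<close>

lemma underdetermined_system:
  fixes a :: "nat \<Rightarrow> 'b \<Rightarrow> 'a::field"
  assumes "finite A" "finite B" "card A < card B"
  shows "\<exists>w. (\<exists>k\<in>B. w k \<noteq> 0) \<and> (\<forall>j\<in>A. (\<Sum>k\<in>B. w k * a k j) = 0)"
  using assms
proof (induction A arbitrary: B a rule: finite_induct)
  case empty
  then have "B \<noteq> {}" by auto
  then show ?case by (intro exI[of _ "\<lambda>_. 1"]) auto
next
  case (insert j A)
  show ?case
  proof (cases "\<forall>k\<in>B. a k j = 0")
    case True
    have "card A < card B" using insert by simp
    then obtain w where w: "\<exists>k\<in>B. w k \<noteq> 0" "\<forall>j\<in>A. (\<Sum>k\<in>B. w k * a k j) = 0"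
      using insert.IH[OF insert.prems(1), of a] by blast
    then show ?thesis using True by (intro exI[of _ w]) auto
  next
    case False
    then obtain k0 where k0: "k0 \<in> B" "a k0 j \<noteq> 0" by blast
    define a' where "a' = (\<lambda>k i. a k i - a k j / a k0 j * a k0 i)"
    have "finite (B - {k0})" "card A < card (B - {k0})"
      using insert k0 by (auto simp: card_Diff_singleton)
    then obtain w where w: "\<exists>k\<in>B - {k0}. w k \<noteq> 0" "\<forall>j\<in>A. (\<Sum>k\<in>B - {k0}. w k * a' k j) = 0"
      using insert.IH[of "B - {k0}" a'] by blast
    define S where "S = (\<Sum>k\<in>B - {k0}. w k * a k j)"
    define w' where "w' = w(k0 := - S / a k0 j)"
    have split: "(\<Sum>k\<in>B. w' k * a k i) = - S / a k0 j * a k0 i + (\<Sum>k\<in>B - {k0}. w k * a k i)" for i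
      using sum.remove[OF insert.prems(1) k0(1), of "\<lambda>k. w' k * a k i"] by (simp add: w'_def)
    have "(\<Sum>k\<in>B. w' k * a k i) = 0" if "i \<in> insert j A" for i
    proof (cases "i = j")
      case True
      then show ?thesis using k0 split by (simp add: S_def)
    next
      case False
      then have "(\<Sum>k\<in>B - {k0}. w k * a' k i) = 0" using w that by auto
      moreover have "(\<Sum>k\<in>B - {k0}. w k * a' k i) = (\<Sum>k\<in>B - {k0}. w k * a k i) - S / a k0 j * a k0 i"
        by (simp add: a'_def S_def right_diff_distrib sum_subtractf sum_distrib_right sum_divide_distrib mult.assoc)
      ultimately show ?thesis using split by simp
    qed
    moreover have "\<exists>k\<in>B. w' k \<noteq> 0" using w(1) by (auto simp: w'_def)
    ultimately show ?thesis by blast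
  qed
qed

text \<open>If column \<open>j0\<close> vanished, the other \<open>p - 1\<close> equations in
  \<open>p\<close> unknowns would have a nontrivial solution, against nondegeneracy.\<close>

lemma nondegenerate_column_nonzero:
  fixes s :: "nat \<Rightarrow> nat \<Rightarrow> nat"
  assumes "finite A" "card A = p" "j0 \<in> A"
    and nondeg: "\<And>w :: nat \<Rightarrow> rat. (\<forall>j\<in>A. (\<Sum>k=1..p. w k * of_nat (s k j)) = 0) \<Longrightarrow> \<forall>k\<in>{1..p}. w k = 0"
  shows "\<exists>k\<in>{1..p}. s k j0 \<noteq> 0"
proof (rule ccontr)
  assume neg: "\<not> ?thesis"
  have "card (A - {j0}) < card {1..p}"
    using assms card_gt_0_iff[of A] by (auto simp: card_Diff_singleton)
  then obtain w :: "nat \<Rightarrow> rat" where w: "\<exists>k\<in>{1..p}. w k \<noteq> 0"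
    "\<forall>j\<in>A - {j0}. (\<Sum>k=1..p. w k * of_nat (s k j)) = 0"
    using underdetermined_system[of "A - {j0}" "{1..p}" "\<lambda>k j. of_nat (s k j)"] assms(1) by auto
  have "\<forall>j\<in>A. (\<Sum>k=1..p. w k * of_nat (s k j)) = 0"
  proof
    fix j assume "j \<in> A"
    then show "(\<Sum>k=1..p. w k * of_nat (s k j)) = 0"
      using w(2) neg by (cases "j = j0") auto
  qed
  from nondeg[OF this] show False using w(1) by blast
qed

lemma sum_four_points:
  fixes f :: "nat \<Rightarrow> 'a::comm_ring_1"
  assumes "finite A"
  shows "(\<Sum>x\<in>A. ((if x = j then 1 else 0) - (if x = k then m else 0) - (if x = l then n else 0)
      - (if x = i then r else 0)) * f x) =
    (if j \<in> A then f j else 0) - (if k \<in> A then m * f k else 0) - (if l \<in> A then n * f l else 0)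
      - (if i \<in> A then r * f i else 0)"
proof -
  have *: "(\<Sum>x\<in>A. (if x = y then t else 0) * f x) = (if y \<in> A then t * f y else 0)" for y t
    using assms by (simp add: if_distrib[of "\<lambda>u. u * f _"] sum.delta cong: if_cong)
  show ?thesis by (simp only: left_diff_distrib sum_subtractf * mult_1)
qed

text \<open>The exponent of \<open>q k\<close> in the coefficient of index \<open>x\<close>, set to
  0 at the first triangle, where the coefficients are 1.\<close>

definition q_expo :: "(nat set \<Rightarrow> nat \<Rightarrow> nat \<Rightarrow> nat) \<Rightarrow> nat \<Rightarrow> nat \<Rightarrow> nat" where
  "q_expo s k x = (if x \<in> {1, 2, 3} then 0 else s {1, 2, 3} k x)"

lemma abs_a_coef: "\<bar>a_coef p s q x\<bar> = (\<Prod>k=1..p. \<bar>q k\<bar> ^ q_expo s k x)"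
  by (simp add: a_coef_def q_expo_def abs_prod power_abs)

lemma ln_abs_a_coef:
  assumes "\<And>k. k \<in> {1..p} \<Longrightarrow> q k \<noteq> 0"
  shows "ln \<bar>a_coef p s q x\<bar> = (\<Sum>k=1..p. real (q_expo s k x) * ln \<bar>q k\<bar>)"
  unfolding abs_a_coef using assms by (subst ln_prod) (auto simp: ln_realpow)

text \<open>Evaluate the class on the affine relation \<open>v\<close> expressing \<open>b j\<close>
  by the vertices of \<open>\<sigma>\<close>. In the basis of \<open>\<sigma>\<close> only the
  coefficient at \<open>j\<close> survives; in the basis of the first triangle one gets the
  exponents of the coefficients.\<close>

lemma expo_change_of_triangle:
  assumes T: "\<sigma> = {i, k, l}" "\<sigma> \<subseteq> {1..p+3}" "{1, 2, 3} \<subseteq> {1..p+3}"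
    and H: "\<And>v. v \<in> LQ b (p+3) \<Longrightarrow> H v = (\<Sum>x\<in>{1..p+3} - \<sigma>. of_nat (s \<sigma> \<kappa> x) * v x)"
    and H1: "\<And>v. v \<in> LQ b (p+3) \<Longrightarrow> H v = (\<Sum>x\<in>{1..p+3} - {1, 2, 3}. of_nat (s {1, 2, 3} \<kappa> x) * v x)"
    and j: "j \<in> {1..p+3} - \<sigma>"
    and rel: "fst (b j) - fst (b i) = m * (fst (b k) - fst (b i)) + n * (fst (b l) - fst (b i))"
      "snd (b j) - snd (b i) = m * (snd (b k) - snd (b i)) + n * (snd (b l) - snd (b i))"
  shows "int (s \<sigma> \<kappa> j) = int (q_expo s \<kappa> j) - m * int (q_expo s \<kappa> k) - n * int (q_expo s \<kappa> l)
    - (1 - m - n) * int (q_expo s \<kappa> i)"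
proof -
  let ?I = "{1..p+3}"
  define v :: "nat \<Rightarrow> rat" where "v = (\<lambda>x. (if x = j then 1 else 0) - (if x = k then of_int m else 0)
    - (if x = l then of_int n else 0) - (if x = i then of_int (1 - m - n) else 0))"
  have inI: "i \<in> ?I" "k \<in> ?I" "l \<in> ?I" "j \<in> ?I" and notin: "i \<in> \<sigma>" "k \<in> \<sigma>" "l \<in> \<sigma>" using T j by auto
  have sum: "(\<Sum>x\<in>?I. v x * of_int (g x)) = of_int (g j - m * g k - n * g l - (1 - m - n) * g i)" for g
    unfolding v_def by (subst sum_four_points) (use inI in simp_all)
  have "v \<in> LQ b (p+3)"
    unfolding LQ_def
  proof (intro CollectI conjI allI impI)
    fix x assume "x \<notin> {1..p+3}"
    then show "v x = 0" using inI by (auto simp: v_def)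
  next
    have "fst (b j) - m * fst (b k) - n * fst (b l) - (1 - m - n) * fst (b i) = 0"
      using rel(1) by (simp add: algebra_simps)
    then show "(\<Sum>x=1..p+3. v x * of_int (fst (b x))) = 0" unfolding sum by simp
    have "snd (b j) - m * snd (b k) - n * snd (b l) - (1 - m - n) * snd (b i) = 0"
      using rel(2) by (simp add: algebra_simps)
    then show "(\<Sum>x=1..p+3. v x * of_int (snd (b x))) = 0" unfolding sum by simp
    show "(\<Sum>x=1..p+3. v x) = 0" using sum[of "\<lambda>_. 1"] by simp
  qed
  from H[OF this] H1[OF this]
  have "(\<Sum>x\<in>?I - \<sigma>. of_nat (s \<sigma> \<kappa> x) * v x) = (\<Sum>x\<in>?I - {1, 2, 3}. of_nat (s {1, 2, 3} \<kappa> x) * v x)"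
    by simp
  also have "\<dots> = (\<Sum>x\<in>?I - {1, 2, 3}. v x * of_int (int (q_expo s \<kappa> x)))"
    by (intro sum.cong) (auto simp: q_expo_def)
  \<comment> \<open>\<open>q_expo\<close> vanishes on the first triangle, so the sum extends to all
    indices.\<close>
  also have "\<dots> = (\<Sum>x\<in>?I. v x * of_int (int (q_expo s \<kappa> x)))"
    by (intro sum.mono_neutral_left) (auto simp: q_expo_def)
  finally have "(\<Sum>x\<in>?I - \<sigma>. of_nat (s \<sigma> \<kappa> x) * v x) =
      of_int (int (q_expo s \<kappa> j) - m * int (q_expo s \<kappa> k) - n * int (q_expo s \<kappa> l) - (1 - m - n) * int (q_expo s \<kappa> i))"
    unfolding sum .
  moreover have "(\<Sum>x\<in>?I - \<sigma>. of_nat (s \<sigma> \<kappa> x) * v x) = (\<Sum>x\<in>?I - \<sigma>. v x * of_nat (s \<sigma> \<kappa> x))"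
    by (simp add: mult.commute)
  moreover have "\<dots> = of_nat (s \<sigma> \<kappa> j)"
    unfolding v_def by (subst sum_four_points) (use j notin in auto)
  ultimately have "rat_of_int (int (s \<sigma> \<kappa> j)) = of_int (int (q_expo s \<kappa> j) - m * int (q_expo s \<kappa> k)
      - n * int (q_expo s \<kappa> l) - (1 - m - n) * int (q_expo s \<kappa> i))"
    by simp
  then show ?thesis by (simp only: of_int_eq_iff)
qed

text \<open>By the change of triangle the left side is the sum of
  \<open>s {i, k, l} \<kappa> j * ln \<bar>q \<kappa>\<bar>\<close>. No summand is positive, and by
  nondegeneracy some exponent is at least 1, whose summand is at most
  \<open>- \<Lambda>\<close>.\<close>

lemma coef_gap:
  assumes T: "{i, k, l} \<subseteq> {1..p+3}" "card {i, k, l} = 3"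
    and H: "\<And>\<kappa> v. \<kappa> \<in> {1..p} \<Longrightarrow> v \<in> LQ b (p+3) \<Longrightarrow>
      H \<kappa> v = (\<Sum>x\<in>{1..p+3} - {i, k, l}. of_nat (s {i, k, l} \<kappa> x) * v x)"
    and H1: "\<And>\<kappa> v. \<kappa> \<in> {1..p} \<Longrightarrow> v \<in> LQ b (p+3) \<Longrightarrow>
      H \<kappa> v = (\<Sum>x\<in>{1..p+3} - {1, 2, 3}. of_nat (s {1, 2, 3} \<kappa> x) * v x)"
    and nondeg: "\<And>w :: nat \<Rightarrow> rat.
      (\<forall>j\<in>{1..p+3} - {i, k, l}. (\<Sum>\<kappa>=1..p. w \<kappa> * of_nat (s {i, k, l} \<kappa> j)) = 0) \<Longrightarrow> \<forall>\<kappa>\<in>{1..p}. w \<kappa> = 0"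
    and j: "j \<in> {1..p+3} - {i, k, l}"
    and rel: "fst (b j) - fst (b i) = m * (fst (b k) - fst (b i)) + n * (fst (b l) - fst (b i))"
      "snd (b j) - snd (b i) = m * (snd (b k) - snd (b i)) + n * (snd (b l) - snd (b i))"
    and q: "\<And>\<kappa>. \<kappa> \<in> {1..p} \<Longrightarrow> q \<kappa> \<noteq> 0" "\<And>\<kappa>. \<kappa> \<in> {1..p} \<Longrightarrow> \<bar>q \<kappa>\<bar> < exp (- \<Lambda>)" and \<Lambda>: "\<Lambda> \<ge> 0"
  shows "ln \<bar>a_coef p s q j\<bar> - of_int m * ln \<bar>a_coef p s q k\<bar> - of_int n * ln \<bar>a_coef p s q l\<bar>
    - (1 - of_int m - of_int n) * ln \<bar>a_coef p s q i\<bar> \<le> - \<Lambda>"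
proof -
  let ?s = "\<lambda>\<kappa>. s {i, k, l} \<kappa> j"
  have lnq: "ln \<bar>q \<kappa>\<bar> \<le> - \<Lambda>" if "\<kappa> \<in> {1..p}" for \<kappa>
    using q(1)[OF that] q(2)[OF that] by (metis less_imp_le ln_exp ln_le_cancel_iff exp_gt_zero zero_less_abs_iff)
  have eq: "real (?s \<kappa>) = real (q_expo s \<kappa> j) - of_int m * real (q_expo s \<kappa> k) - of_int n * real (q_expo s \<kappa> l)
      - (1 - of_int m - of_int n) * real (q_expo s \<kappa> i)" if "\<kappa> \<in> {1..p}" for \<kappa>
  proof -
    have "int (?s \<kappa>) = int (q_expo s \<kappa> j) - m * int (q_expo s \<kappa> k) - n * int (q_expo s \<kappa> l)
      - (1 - m - n) * int (q_expo s \<kappa> i)"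
      using H[OF that] H1[OF that]
      by (intro expo_change_of_triangle[where H = "H \<kappa>" and \<sigma> = "{i, k, l}", OF refl T(1) _ _ _ j rel]) auto
    then have "real_of_int (int (?s \<kappa>)) = of_int (int (q_expo s \<kappa> j) - m * int (q_expo s \<kappa> k) - n * int (q_expo s \<kappa> l)
      - (1 - m - n) * int (q_expo s \<kappa> i))" by (simp only:)
    then show ?thesis by simp
  qed
  have "card ({1..p+3} - {i, k, l}) = p" using T by (simp add: card_Diff_subset)
  then obtain \<kappa>0 where \<kappa>0: "\<kappa>0 \<in> {1..p}" "?s \<kappa>0 \<noteq> 0"
    using nondegenerate_column_nonzero[of "{1..p+3} - {i, k, l}" p j "s {i, k, l}"] j nondeg by blast
  have "ln \<bar>a_coef p s q j\<bar> - of_int m * ln \<bar>a_coef p s q k\<bar> - of_int n * ln \<bar>a_coef p s q l\<bar>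
      - (1 - of_int m - of_int n) * ln \<bar>a_coef p s q i\<bar> = (\<Sum>\<kappa>=1..p. real (?s \<kappa>) * ln \<bar>q \<kappa>\<bar>)"
  proof -
    have "(\<Sum>\<kappa>=1..p. real (?s \<kappa>) * ln \<bar>q \<kappa>\<bar>) =
      (\<Sum>\<kappa>=1..p. real (q_expo s \<kappa> j) * ln \<bar>q \<kappa>\<bar> - of_int m * (real (q_expo s \<kappa> k) * ln \<bar>q \<kappa>\<bar>)
        - of_int n * (real (q_expo s \<kappa> l) * ln \<bar>q \<kappa>\<bar>)
        - (1 - of_int m - of_int n) * (real (q_expo s \<kappa> i) * ln \<bar>q \<kappa>\<bar>))"
      by (rule sum.cong) (simp_all add: eq left_diff_distrib mult.assoc)
    then show ?thesis
      by (simp only: sum_subtractf ln_abs_a_coef[OF q(1)] flip: sum_distrib_left)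
  qed
  also have "\<dots> \<le> (\<Sum>\<kappa>=1..p. if \<kappa> = \<kappa>0 then - \<Lambda> else 0)"
  proof (rule sum_mono)
    fix \<kappa> assume \<kappa>: "\<kappa> \<in> {1..p}"
    show "real (?s \<kappa>) * ln \<bar>q \<kappa>\<bar> \<le> (if \<kappa> = \<kappa>0 then - \<Lambda> else 0)"
    proof (cases "\<kappa> = \<kappa>0")
      case True
      then have "real (?s \<kappa>) * ln \<bar>q \<kappa>\<bar> \<le> 1 * ln \<bar>q \<kappa>\<bar>"
        using \<kappa>0 lnq[OF \<kappa>] \<Lambda> by (intro mult_right_mono_neg) auto
      then show ?thesis using True lnq[OF \<kappa>] by simp
    next
      case False
      then show ?thesis using lnq[OF \<kappa>] \<Lambda> by (auto simp: mult_le_0_iff)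
    qed
  qed
  also have "\<dots> = - \<Lambda>" using \<kappa>0 by simp
  finally show ?thesis .
qed

section \<open>The torus in the real toric surface\<close>

text \<open>An equation between functions continuous only on the open set \<open>U\<close> survives
  passage to those limit points that lie in \<open>U\<close>.\<close>

lemma zero_on_closure:
  fixes g :: "'a::topological_space \<Rightarrow> 'b::t1_space"
  assumes "open U" "continuous_on U g" "\<And>x. x \<in> S \<Longrightarrow> x \<in> U \<Longrightarrow> g x = a" "x \<in> U" "x \<in> closure S"
  shows "g x = a"
proof -
  have "closedin (top_of_set U) {x \<in> U. g x = a}"
    by (rule continuous_closedin_preimage_constant[OF assms(2)])
  then obtain K where K: "closed K" "{x \<in> U. g x = a} = U \<inter> K"
    by (auto simp: closedin_closed)
  have "x \<in> closure (U \<inter> S)" using open_Int_closure_subset[OF assms(1)] assms(4,5) by blast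
  moreover have "U \<inter> S \<subseteq> K" using K(2) assms(3) by blast
  ultimately have "x \<in> K" using closure_minimal[OF _ K(1)] by blast
  then show ?thesis using K(2) assms(4) by blast
qed

text \<open>In a larger connected subset of \<open>C\<close> the set \<open>Z\<close> would still be
  open and closed.\<close>

lemma clopen_connected_component:
  assumes "Z \<noteq> {}" "connected Z" "openin (top_of_set C) Z" "closedin (top_of_set C) Z"
  shows "Z \<in> components C"
  unfolding in_components_maximal
proof (intro conjI allI impI)
  show "Z \<subseteq> C" using assms(3) by (simp add: openin_imp_subset)
  fix d assume d: "d \<noteq> {} \<and> Z \<subseteq> d \<and> d \<subseteq> C \<and> connected d"
  have "openin (top_of_set d) Z" "closedin (top_of_set d) Z"
    using d assms(3,4) by (meson openin_subset_trans closedin_subset_trans)+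
  then have "Z = {} \<or> Z = d" using d by (meson connected_clopen)
  then show "d = Z" using assms(1) by blast
qed (use assms in auto)

locale toric_chart =
  fixes b :: "nat \<Rightarrow> int \<times> int" and p :: nat
  assumes b123: "b 1 = (1, 0)" "b 2 = (0, 1)" "b 3 = (0, 0)"
begin

abbreviation "emb \<equiv> toric_embed b (p + 3)"

text \<open>Since \<open>b\<^sub>1, b\<^sub>2, b\<^sub>3\<close> have monomials \<open>x\<close>, \<open>y\<close> and \<open>1\<close>, these matrix entries recover \<open>(x, y)\<close>.\<close>
definition psi :: "(nat \<times> nat \<Rightarrow> real) \<Rightarrow> real \<times> real" where
  "psi A = (A (1, 3) / A (3, 3), A (2, 3) / A (3, 3))"

text \<open>An open set of arbitrary matrices, not only of points of the surface, so that openness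
  and the continuity of \<open>psi\<close> can be checked entrywise.\<close>

definition affine_part :: "(nat \<times> nat \<Rightarrow> real) set" where
  "affine_part = {A. A (3, 3) \<noteq> 0 \<and> A (1, 3) \<noteq> 0 \<and> A (2, 3) \<noteq> 0}"

lemma mono_123:
  "mono_vec b (p + 3) z 1 = fst z" "mono_vec b (p + 3) z 2 = snd z" "mono_vec b (p + 3) z 3 = 1"
  using b123 by (simp_all add: mono_vec_def)

lemma norm_pos: "(\<Sum>k=1..p+3. (mono_vec b (p + 3) z k)\<^sup>2) > 0"
proof -
  have "(mono_vec b (p + 3) z 3)\<^sup>2 \<le> (\<Sum>k=1..p+3. (mono_vec b (p + 3) z k)\<^sup>2)"
    by (rule member_le_sum) auto
  then show ?thesis by (simp add: mono_123)
qed

lemma psi_emb: "psi (emb z) = z"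
  using norm_pos[of z] unfolding psi_def toric_embed_def prod.case mono_123 by (simp add: prod_eq_iff)

lemma emb_affine: "z \<in> real_torus \<Longrightarrow> emb z \<in> affine_part"
  using norm_pos[of z] unfolding affine_part_def toric_embed_def mem_Collect_eq prod.case mono_123
  by (auto simp: real_torus_def)

lemma psi_torus: "A \<in> affine_part \<Longrightarrow> psi A \<in> real_torus"
  by (simp add: affine_part_def psi_def real_torus_def)

lemma coord_continuous: "continuous_on S (\<lambda>A :: nat \<times> nat \<Rightarrow> real. A x)"
  by (rule continuous_on_subset[OF continuous_on_product_coordinates]) simp

lemma open_affine_part: "open affine_part"
proof -
  have "open {A :: nat \<times> nat \<Rightarrow> real. A x \<noteq> 0}" for x
    by (rule open_Collect_neq[OF coord_continuous continuous_on_const])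
  moreover have "affine_part = {A. A (3, 3) \<noteq> 0} \<inter> ({A. A (1, 3) \<noteq> 0} \<inter> {A. A (2, 3) \<noteq> 0})"
    by (auto simp: affine_part_def)
  ultimately show ?thesis by (metis open_Int)
qed

lemma psi_continuous: "continuous_on affine_part psi"
  unfolding psi_def
  by (intro continuous_intros coord_continuous) (auto simp: affine_part_def)

lemma mono_continuous: "continuous_on real_torus (\<lambda>z. mono_vec b (p + 3) z i)"
  by (cases "i \<in> {1..p+3}")
    (auto simp: mono_vec_def real_torus_def intro!: continuous_intros)

lemma emb_continuous: "continuous_on real_torus emb"
proof (rule continuous_on_coordinatewise_then_product)
  fix x :: "nat \<times> nat"
  obtain i j where x: "x = (i, j)" by (cases x)
  show "continuous_on real_torus (\<lambda>z. emb z x)"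
    unfolding toric_embed_def x prod.case
    by (intro continuous_intros mono_continuous) (use norm_pos in \<open>auto simp: less_le\<close>)
qed

lemma mirror_H_continuous: "continuous_on real_torus (\<lambda>z. mirror_H b p s q (fst z) (snd z))"
  unfolding mirror_H_def by (auto simp: real_torus_def intro!: continuous_intros)

lemma curve_closure_closed: "closed (curve_closure b p s q)"
  unfolding curve_closure_def real_toric_surface_def by (intro closed_Int closed_closure)

lemma curve_subset_torus: "real_curve b p s q \<subseteq> real_torus"
  by (auto simp: real_curve_def)

lemma emb_curve_subset: "emb ` real_curve b p s q \<subseteq> curve_closure b p s q"
proof -
  have "emb ` real_curve b p s q \<subseteq> closure (emb ` real_torus)"
    using curve_subset_torus closure_subset by blast
  then show ?thesis
    using closure_subset unfolding curve_closure_def real_toric_surface_def by blast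
qed

text \<open>Taking the closure adds no points inside the torus: vanishing of the polynomial at
  \<open>psi A\<close> and \<open>A = emb (psi A)\<close> are closed conditions on
  \<open>affine_part\<close> that hold on the embedded curve.\<close>

lemma curve_closure_affine:
  assumes "A \<in> curve_closure b p s q" "A \<in> affine_part"
  shows "psi A \<in> real_curve b p s q" "A = emb (psi A)"
proof -
  let ?S = "emb ` real_curve b p s q"
  have cl: "A \<in> closure ?S" using assms(1) by (simp add: curve_closure_def)
  have img: "psi ` affine_part \<subseteq> real_torus" using psi_torus by blast
  have "mirror_H b p s q (fst (psi A)) (snd (psi A)) = 0"
    by (rule zero_on_closure[OF open_affine_part continuous_on_compose2[OF mirror_H_continuous psi_continuous img] _ assms(2) cl])
      (auto simp: psi_emb real_curve_def)
  then show "psi A \<in> real_curve b p s q"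
    using psi_torus[OF assms(2)] by (auto simp: real_curve_def case_prod_unfold)
  have embpsi: "continuous_on affine_part (\<lambda>A. emb (psi A) x - A x)" for x
  proof (intro continuous_on_diff coord_continuous)
    have "continuous_on affine_part (\<lambda>A. emb (psi A))"
      by (rule continuous_on_compose2[OF emb_continuous psi_continuous img])
    then show "continuous_on affine_part (\<lambda>A. emb (psi A) x)"
      by (rule continuous_on_product_then_coordinatewise)
  qed
  show "A = emb (psi A)"
  proof
    fix x
    have "emb (psi A) x - A x = 0"
      by (rule zero_on_closure[OF open_affine_part embpsi _ assms(2) cl]) (auto simp: psi_emb)
    then show "A x = emb (psi A) x" by simp
  qed
qed

text \<open>Compactness makes the image closed. The open set \<open>Q\<close>, pulled back by
  \<open>psi\<close>, makes it relatively open, and also keeps it away from points of the closure at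
  the toric boundary.\<close>

lemma compact_open_part_component:
  assumes Z: "Z \<noteq> {}" "compact Z" "connected Z" "open Q" "Z = real_curve b p s q \<inter> Q"
  shows "emb ` Z \<in> components (curve_closure b p s q)"
proof (rule clopen_connected_component)
  let ?C = "curve_closure b p s q"
  have sub: "Z \<subseteq> real_torus" using Z(5) curve_subset_torus by blast
  then have cont: "continuous_on Z emb" using emb_continuous continuous_on_subset by blast
  show "emb ` Z \<noteq> {}" "connected (emb ` Z)" using Z cont connected_continuous_image by blast+
  have ZC: "emb ` Z \<subseteq> ?C" using Z(5) emb_curve_subset by blast
  have "closed (emb ` Z)" using Z(2) cont compact_continuous_image compact_imp_closed by blast
  then show "closedin (top_of_set ?C) (emb ` Z)" using ZC by (simp add: closed_subset)
  have "open (affine_part \<inter> psi -` Q)"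
    by (rule continuous_open_preimage[OF psi_continuous open_affine_part Z(4)])
  moreover have "emb ` Z = ?C \<inter> (affine_part \<inter> psi -` Q)"
  proof
    show "emb ` Z \<subseteq> ?C \<inter> (affine_part \<inter> psi -` Q)"
      using ZC Z(5) emb_affine sub psi_emb by fastforce
    show "?C \<inter> (affine_part \<inter> psi -` Q) \<subseteq> emb ` Z"
      using curve_closure_affine Z(5) by blast
  qed
  ultimately show "openin (top_of_set ?C) (emb ` Z)" by (metis openin_open_Int)
qed

definition log_chart :: "real \<Rightarrow> real \<Rightarrow> real \<times> real \<Rightarrow> real \<times> real" where
  "log_chart sx sy z = (sx * exp (fst z), sy * exp (snd z))"

lemma log_chart_continuous: "continuous_on A (log_chart sx sy)"
  unfolding log_chart_def by (intro continuous_intros)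

lemma log_chart_torus: "sx \<in> {1, -1} \<Longrightarrow> sy \<in> {1, -1} \<Longrightarrow> log_chart sx sy z \<in> real_torus"
  by (auto simp: log_chart_def real_torus_def)

lemma log_chart_surj:
  assumes "z \<in> real_torus"
  obtains sx sy y where "sx \<in> {1, -1}" "sy \<in> {1, -1}" "z = log_chart sx sy y"
proof
  show "z = log_chart (sgn (fst z)) (sgn (snd z)) (ln \<bar>fst z\<bar>, ln \<bar>snd z\<bar>)"
    using assms by (auto simp: log_chart_def real_torus_def sgn_mult_abs)
  show "sgn (fst z) \<in> {1, -1}" "sgn (snd z) \<in> {1, -1}"
    using assms by (auto simp: real_torus_def sgn_if)
qed

lemma log_chart_quadrant:
  assumes "sx \<in> {1, -1}" "sy \<in> {1, -1}"
  shows "range (log_chart sx sy) = {z. sx * fst z > 0 \<and> sy * snd z > 0}"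
proof
  show "range (log_chart sx sy) \<subseteq> {z. sx * fst z > 0 \<and> sy * snd z > 0}"
    using assms by (auto simp: log_chart_def)
  show "{z. sx * fst z > 0 \<and> sy * snd z > 0} \<subseteq> range (log_chart sx sy)"
  proof
    fix z assume "z \<in> {z. sx * fst z > 0 \<and> sy * snd z > 0}"
    then have "z = log_chart sx sy (ln (sx * fst z), ln (sy * snd z))"
      using assms by (auto simp: log_chart_def)
    then show "z \<in> range (log_chart sx sy)" by blast
  qed
qed

lemma log_chart_range_open: "sx \<in> {1, -1} \<Longrightarrow> sy \<in> {1, -1} \<Longrightarrow> open (range (log_chart sx sy))"
  unfolding log_chart_quadrant
  by (intro open_Collect_conj open_Collect_less continuous_intros)

end

section \<open>The oval of an interior lattice point\<close>

text \<open>The number \<open>p + 2\<close> counts the lattice points other than \<open>b i\<close>;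
  it becomes \<open>card J\<close> in \<open>star\<close>.\<close>

locale mirror_setup = triangulated_polygon P b "p + 3" T M + toric_chart b p
  for P :: "(real \<times> real) set" and b :: "nat \<Rightarrow> int \<times> int" and p :: nat and T :: "nat set set" and M :: nat +
  fixes s :: "nat set \<Rightarrow> nat \<Rightarrow> nat \<Rightarrow> nat" and q :: "nat \<Rightarrow> real" and c \<Lambda> :: real and i :: nat
  assumes i: "i \<in> {1..p+3}" "pt b i \<in> interior P"
    and gap: "{i, k, l} \<in> T \<Longrightarrow> j \<in> {1..p+3} - {i, k, l} \<Longrightarrow>
      pt b j - pt b i = of_int m *\<^sub>R (pt b k - pt b i) + of_int n *\<^sub>R (pt b l - pt b i) \<Longrightarrow>
      ln \<bar>a_coef p s q j\<bar> - of_int m * ln \<bar>a_coef p s q k\<bar> - of_int n * ln \<bar>a_coef p s q l\<bar>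
        - (1 - of_int m - of_int n) * ln \<bar>a_coef p s q i\<bar> \<le> - \<Lambda>"
    and sign: "j \<in> {1..p+3} \<Longrightarrow> sgn (a_coef p s q j) = (if odd (fst (b j)) \<and> odd (snd (b j)) then - 1 else 1)"
    and c_pos: "c > 0"
    and Mc: "real M * c \<le> 1 / 3"
    and small: "real (p + 2) * real M * exp (real M * (2 * real (p + 2) + 2 * c) - \<Lambda>) < min c (1 / 18)"
    and deep: "\<Lambda> \<ge> 10 * real (p + 2) * real M + 5 * real (p + 2)"
begin

definition h :: "nat \<Rightarrow> real \<times> real \<Rightarrow> real" where
  "h j z = a_coef p s q j * fst z powi fst (b j) * snd z powi snd (b j)"

text \<open>The sign of the term \<open>h j\<close> in the quadrant with signs \<open>sx\<close>,
  \<open>sy\<close>: the factors come from the coefficient, the power of x and the power of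
  y.\<close>

definition sg :: "real \<Rightarrow> real \<Rightarrow> nat \<Rightarrow> real" where
  "sg sx sy j = (if odd (fst (b j)) \<and> odd (snd (b j)) then - 1 else 1)
    * (if odd (fst (b j)) then sx else 1) * (if odd (snd (b j)) then sy else 1)"

abbreviation "J \<equiv> {1..p+3} - {i}"
abbreviation "E \<equiv> {(k, l). {i, k, l} \<in> T}"
abbreviation "dir j \<equiv> pt b j - pt b i"
abbreviation "ht j \<equiv> ln \<bar>a_coef p s q j\<bar> - ln \<bar>a_coef p s q i\<bar>"
abbreviation "tsign sx sy j \<equiv> sg sx sy j * sg sx sy i"
abbreviation "C \<equiv> curve_closure b p s q"

lemma star_instance:
  assumes "sx \<in> {1, -1}" "sy \<in> {1, -1}"
  shows "star J E dir ht (tsign sx sy) M c \<Lambda>"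
proof -
  have card: "card J = p + 2" using i by (simp add: card_Diff_singleton)
  have ne: "k \<noteq> i" "l \<noteq> i" if "{i, k, l} \<in> T" for k l
    using tri_det[OF that] by (auto simp: det2_def)
  show ?thesis
  proof
    show "finite J" by simp
    show "k \<in> J \<and> l \<in> J" if "(k, l) \<in> E" for k l
      using that ne T_sub[of "{i, k, l}"] by auto
    show "(l, k) \<in> E" if "(k, l) \<in> E" for k l
      using that by (simp add: insert_commute)
    show "det2 (dir k) (dir l) \<noteq> 0" if "(k, l) \<in> E" for k l
      using tri_det[of i k l] that by auto
    show "dir j \<noteq> 0" if "j \<in> J" for j
      using pt_eq_iff[of j i] i that by auto
    show "\<exists>k l m n. (k, l) \<in> E \<and> m \<ge> 0 \<and> n \<ge> 0 \<and> w = m *\<^sub>R dir k + n *\<^sub>R dir l" for w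
    proof -
      obtain k l m n where "{i, k, l} \<in> T" "m \<ge> 0" "n \<ge> 0" "w = m *\<^sub>R dir k + n *\<^sub>R dir l"
        by (rule interior_cone[OF i])
      then show ?thesis by (intro exI[of _ k] exI[of _ l] exI[of _ m] exI[of _ n]) simp
    qed
    show "\<exists>m n :: int. dir j = of_int m *\<^sub>R dir k + of_int n *\<^sub>R dir l \<and> \<bar>m\<bar> \<le> int M \<and> \<bar>n\<bar> \<le> int M"
      if kl: "(k, l) \<in> E" and j: "j \<in> J" for k l j
    proof -
      have "{i, k, l} \<in> T" "j \<in> {1..p+3}" using kl j by auto
      from tri_coords[OF this] show ?thesis by metis
    qed
    show "ht j \<le> m * ht k + n * ht l - \<Lambda>"
      if kl: "(k, l) \<in> E" and j: "j \<in> J" "j \<noteq> k" "j \<noteq> l" and eq: "dir j = m *\<^sub>R dir k + n *\<^sub>R dir l" for k l j m n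
    proof -
      have T: "{i, k, l} \<in> T" "j \<in> {1..p+3}" "j \<in> {1..p+3} - {i, k, l}" using kl j by auto
      \<comment> \<open>In \<open>star\<close> the coefficients are real; by uniqueness they equal
        the integer coordinates to which \<open>gap\<close> applies.\<close>
      obtain m' n' :: int where mn: "dir j = of_int m' *\<^sub>R dir k + of_int n' *\<^sub>R dir l"
        by (rule tri_coords[OF T(1,2)])
      have "m *\<^sub>R dir k + n *\<^sub>R dir l = of_int m' *\<^sub>R dir k + of_int n' *\<^sub>R dir l"
        using eq mn by (simp only:)
      from tri_coords_unique[OF T(1) this] have "m = of_int m'" "n = of_int n'" .
      then show ?thesis using gap[OF T(1,3) mn] by (simp only: algebra_simps)
    qed
    show "\<exists>l'. (k, l') \<in> E \<and> det2 (dir k) (dir l) * det2 (dir k) (dir l') < 0" if "(k, l) \<in> E" for k l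
    proof -
      have "{i, k, l} \<in> T" using that by simp
      from opposite_triangle[OF i this] show ?thesis by (metis case_prodI mem_Collect_eq)
    qed
    show "\<bar>tsign sx sy j\<bar> = 1" if "j \<in> J" for j
      using assms by (auto simp: sg_def)
  qed (use c_pos Mc small deep in \<open>simp_all only: card\<close>)
qed

lemma a_nz: "j \<in> {1..p+3} \<Longrightarrow> a_coef p s q j \<noteq> 0"
  using sign by (metis sgn_0 zero_neq_neg_one zero_neq_one)

lemma unit_powi: "sx \<in> {1, -1 :: real} \<Longrightarrow> sx powi m = (if odd m then sx else 1)"
  by (auto simp: power_int_minus_left)

lemma h_chart:
  assumes "sx \<in> {1, -1}" "sy \<in> {1, -1}" "j \<in> {1..p+3}"
  shows "h j (log_chart sx sy y) = sg sx sy j * exp (ln \<bar>a_coef p s q j\<bar> + pt b j \<bullet> y)"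
proof -
  have "a_coef p s q j = sgn (a_coef p s q j) * exp (ln \<bar>a_coef p s q j\<bar>)"
    using a_nz[OF assms(3)] by (simp add: sgn_mult_abs)
  then have "h j (log_chart sx sy y) = (sgn (a_coef p s q j) * exp (ln \<bar>a_coef p s q j\<bar>))
      * (sx powi fst (b j) * exp (fst y) powi fst (b j)) * (sy powi snd (b j) * exp (snd y) powi snd (b j))"
    by (simp only: h_def log_chart_def fst_conv snd_conv power_int_mult_distrib)
  also have "\<dots> = sg sx sy j * (exp (ln \<bar>a_coef p s q j\<bar>) * exp (of_int (fst (b j)) * fst y) * exp (of_int (snd (b j)) * snd y))"
    unfolding sign[OF assms(3)] unit_powi[OF assms(1)] unit_powi[OF assms(2)] exp_power_int sg_def by (simp only: mult_ac)
  also have "exp (ln \<bar>a_coef p s q j\<bar>) * exp (of_int (fst (b j)) * fst y) * exp (of_int (snd (b j)) * snd y)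
      = exp (ln \<bar>a_coef p s q j\<bar> + pt b j \<bullet> y)"
    by (simp only: exp_add[symmetric] pt_def inner_prod_def inner_real_def fst_conv snd_conv add.assoc)
  finally show ?thesis .
qed

lemma sg_square:
  assumes "sx \<in> {1, -1}" "sy \<in> {1, -1}"
  shows "sg sx sy j * sg sx sy j = 1" "\<bar>sg sx sy j\<bar> = 1"
  using assms by (auto simp: sg_def)

text \<open>Factoring the nonvanishing term \<open>h i\<close> out of the polynomial leaves
  \<open>F\<close>. Since \<open>sg\<close> takes the values 1 and -1, the product of two signs is
  also their quotient.\<close>

lemma curve_chart_iff:
  assumes "sx \<in> {1, -1}" "sy \<in> {1, -1}"
  shows "log_chart sx sy y \<in> real_curve b p s q \<longleftrightarrow> star.F J dir ht (tsign sx sy) y = 0"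
proof -
  interpret S: star J E dir ht "tsign sx sy" M c \<Lambda> by (rule star_instance[OF assms])
  let ?z = "log_chart sx sy y"
  have hj: "h j ?z = h i ?z * (tsign sx sy j * exp (S.lam j y))" if "j \<in> {1..p+3}" for j
  proof -
    have "exp (ln \<bar>a_coef p s q j\<bar> + pt b j \<bullet> y) = exp (ln \<bar>a_coef p s q i\<bar> + pt b i \<bullet> y) * exp (S.lam j y)"
      by (simp add: S.lam_def inner_diff_left flip: exp_add)
    then show ?thesis
      unfolding h_chart[OF assms that] h_chart[OF assms i(1)]
      using sg_square(1)[OF assms, of i] by (simp add: mult_ac)
  qed
  have hi: "h i ?z \<noteq> 0"
    unfolding h_chart[OF assms i(1)] using sg_square(2)[OF assms, of i] by auto
  have "mirror_H b p s q (fst ?z) (snd ?z) = (\<Sum>j=1..p+3. h j ?z)" by (simp add: mirror_H_def h_def)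
  also have "\<dots> = h i ?z + (\<Sum>j\<in>J. h j ?z)" using i(1) by (simp add: sum.remove)
  also have "(\<Sum>j\<in>J. h j ?z) = (\<Sum>j\<in>J. h i ?z * (tsign sx sy j * exp (S.lam j y)))"
    by (rule sum.cong) (use hj in auto)
  finally have "mirror_H b p s q (fst ?z) (snd ?z) = h i ?z * S.F y"
    by (simp only: S.F_def distrib_left sum_distrib_left mult_1_right)
  then show ?thesis
    using hi log_chart_torus[OF assms, of y] by (auto simp: real_curve_def case_prod_unfold)
qed

definition dominant :: "real \<times> real \<Rightarrow> bool" where
  "dominant z \<longleftrightarrow> (\<forall>j\<in>{1..p+3}. j \<noteq> i \<longrightarrow> \<bar>h j z\<bar> < (1 + c) * \<bar>h i z\<bar>)"

lemma dominant_chart_iff: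
  assumes "sx \<in> {1, -1}" "sy \<in> {1, -1}"
  shows "dominant (log_chart sx sy y) \<longleftrightarrow> (\<forall>j\<in>J. star.lam dir ht j y < star.L c)"
proof -
  interpret S: star J E dir ht "tsign sx sy" M c \<Lambda> by (rule star_instance[OF assms])
  have "\<bar>h j (log_chart sx sy y)\<bar> < (1 + c) * \<bar>h i (log_chart sx sy y)\<bar> \<longleftrightarrow> S.lam j y < S.L" if "j \<in> J" for j
  proof -
    have j: "j \<in> {1..p+3}" using that by simp
    have "\<bar>h j (log_chart sx sy y)\<bar> = exp (ln \<bar>a_coef p s q j\<bar> + pt b j \<bullet> y)"
      "\<bar>h i (log_chart sx sy y)\<bar> = exp (ln \<bar>a_coef p s q i\<bar> + pt b i \<bullet> y)"
      unfolding h_chart[OF assms j] h_chart[OF assms i(1)] abs_mult sg_square(2)[OF assms] by simp_all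
    moreover have "(1 + c) * exp (ln \<bar>a_coef p s q i\<bar> + pt b i \<bullet> y) = exp (S.L + (ln \<bar>a_coef p s q i\<bar> + pt b i \<bullet> y))"
      using S.L_bounds(3) by (simp add: exp_add)
    ultimately show ?thesis by (simp add: S.lam_def inner_diff_left) linarith
  qed
  then show ?thesis unfolding dominant_def by auto
qed

lemma ovals_chart_iff:
  assumes "sx \<in> {1, -1}" "sy \<in> {1, -1}"
  shows "y \<in> star.ovals J dir ht (tsign sx sy) c \<longleftrightarrow>
    log_chart sx sy y \<in> real_curve b p s q \<and> dominant (log_chart sx sy y)"
proof -
  interpret S: star J E dir ht "tsign sx sy" M c \<Lambda> by (rule star_instance[OF assms])
  show ?thesis
    unfolding S.ovals_def curve_chart_iff[OF assms] dominant_chart_iff[OF assms] by simp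
qed

lemma open_dominant: "open {z \<in> real_torus. dominant z}"
proof -
  have tor: "open real_torus"
  proof -
    have "real_torus = (- {0}) \<times> (- {0})" by (auto simp: real_torus_def)
    moreover have "open ((- {0 :: real}) \<times> (- {0 :: real}))" by (intro open_Times open_Compl closed_singleton)
    ultimately show ?thesis by (simp only:)
  qed
  have hc: "continuous_on real_torus (h j)" for j
    unfolding h_def by (auto simp: real_torus_def intro!: continuous_intros)
  have "open (real_torus \<inter> (\<lambda>z. (1 + c) * \<bar>h i z\<bar> - \<bar>h j z\<bar>) -` {0<..})" for j
    by (rule continuous_open_preimage[OF _ tor]) (intro continuous_intros hc open_greaterThan)+
  then have "open (\<Inter>j\<in>J. real_torus \<inter> (\<lambda>z. (1 + c) * \<bar>h i z\<bar> - \<bar>h j z\<bar>) -` {0<..})"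
    by (intro open_INT) auto
  then have "open (real_torus \<inter> (\<Inter>j\<in>J. real_torus \<inter> (\<lambda>z. (1 + c) * \<bar>h i z\<bar> - \<bar>h j z\<bar>) -` {0<..}))"
    using tor by blast
  moreover have "real_torus \<inter> (\<Inter>j\<in>J. real_torus \<inter> (\<lambda>z. (1 + c) * \<bar>h i z\<bar> - \<bar>h j z\<bar>) -` {0<..})
      = {z \<in> real_torus. dominant z}"
    by (auto simp: dominant_def)
  ultimately show ?thesis by simp
qed

text \<open>In the quadrant with these signs the monomials in the parity class of \<open>b i\<close> have the sign opposite
  to that of all others; in each other quadrant some other parity class is singled out in this way.\<close>
definition ox :: real where "ox = (if odd (snd (b i)) then 1 else - 1)"
definition oy :: real where "oy = (if odd (fst (b i)) then 1 else - 1)"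

lemma ox_oy: "ox \<in> {1, -1}" "oy \<in> {1, -1}"
  by (auto simp: ox_def oy_def)

lemma oval_quadrant_sign:
  assumes "{i, k, l} \<in> T"
  shows "tsign ox oy k = - 1"
  using adjacent_parity[OF assms] by (auto simp: sg_def ox_def oy_def)

text \<open>The vertices of a triangle have three different parity classes, and in every quadrant
  exactly one of the four classes has the sign opposite to the rest. Outside the oval quadrant this
  is not the class of \<open>b i\<close>, so at most one of \<open>k\<close>, \<open>l\<close>
  differs in sign from \<open>i\<close>.\<close>

lemma other_quadrant_sign:
  assumes "{i, k, l} \<in> T" "sx \<in> {1, -1}" "sy \<in> {1, -1}" "(sx, sy) \<noteq> (ox, oy)" "tsign sx sy k = - 1"
  shows "tsign sx sy l = 1"
proof -
  have "{i, l, k} \<in> T" "{k, l, i} \<in> T" using assms(1) by (simp_all add: insert_commute)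
  then have "(odd (fst (b k)), odd (snd (b k))) \<noteq> (odd (fst (b i)), odd (snd (b i)))"
    "(odd (fst (b l)), odd (snd (b l))) \<noteq> (odd (fst (b i)), odd (snd (b i)))"
    "(odd (fst (b l)), odd (snd (b l))) \<noteq> (odd (fst (b k)), odd (snd (b k)))"
    using adjacent_parity assms(1) by metis+
  then show ?thesis
    using assms(2-5)
    by (cases "odd (fst (b i))"; cases "odd (snd (b i))"; cases "odd (fst (b k))"; cases "odd (snd (b k))")
      (auto simp: sg_def ox_def oy_def split: if_splits)
qed

definition oval :: "(real \<times> real) set" where
  "oval = log_chart ox oy ` star.ovals J dir ht (tsign ox oy) c"

lemma oval_component: "emb ` oval \<in> components C"
proof -
  interpret S: star J E dir ht "tsign ox oy" M c \<Lambda> by (rule star_instance[OF ox_oy])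
  have nbneg: "tsign ox oy k = - 1" if "k \<in> S.nb" for k
    using that oval_quadrant_sign by (auto simp: S.nb_def)
  show ?thesis
  proof (rule compact_open_part_component)
    show "oval \<noteq> {}" "compact oval" "connected oval"
      unfolding oval_def using S.ovals_compact_connected[OF nbneg]
      by (auto intro!: compact_continuous_image connected_continuous_image log_chart_continuous)
    show "open (range (log_chart ox oy) \<inter> {z \<in> real_torus. dominant z})"
      using log_chart_range_open[OF ox_oy] open_dominant by blast
    show "oval = real_curve b p s q \<inter> (range (log_chart ox oy) \<inter> {z \<in> real_torus. dominant z})"
      unfolding oval_def using ovals_chart_iff[OF ox_oy] curve_subset_torus by fastforce
  qed
qed

definition dominated_component :: "(nat \<times> nat \<Rightarrow> real) set \<Rightarrow> bool" where
  "dominated_component W \<longleftrightarrow> W \<in> components C \<and> W \<subseteq> emb ` real_torus \<and>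
    (\<forall>z\<in>real_torus. emb z \<in> W \<longrightarrow> dominant z)"

lemma oval_dominated: "dominated_component (emb ` oval)"
  unfolding dominated_component_def
proof (intro conjI ballI impI)
  show "emb ` oval \<in> components C" by (rule oval_component)
  show "emb ` oval \<subseteq> emb ` real_torus"
    unfolding oval_def using log_chart_torus[OF ox_oy] by auto
  fix z assume "emb z \<in> emb ` oval"
  then have "z \<in> oval" by (metis imageE psi_emb)
  then show "dominant z" unfolding oval_def using ovals_chart_iff[OF ox_oy] by auto
qed

text \<open>Any point of \<open>W\<close> determines a quadrant. In the oval quadrant that point
  lies on the oval, and components that meet are equal; in every other quadrant
  \<open>no_trapped_component\<close> gives a contradiction.\<close>

lemma dominated_unique:
  assumes W: "dominated_component W"
  shows "W = emb ` oval"
proof -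
  have comp: "W \<in> components C" and sub: "W \<subseteq> emb ` real_torus"
    and dom: "\<And>z. z \<in> real_torus \<Longrightarrow> emb z \<in> W \<Longrightarrow> dominant z"
    using W by (auto simp: dominated_component_def)
  have WC: "W \<subseteq> C" and "W \<noteq> {}" using comp in_components_subset in_components_nonempty by blast+
  have inc: "z \<in> real_curve b p s q" if "z \<in> real_torus" "emb z \<in> W" for z
    using curve_closure_affine(1)[of "emb z"] that emb_affine WC psi_emb by auto
  obtain z where z: "z \<in> real_torus" "emb z \<in> W" using \<open>W \<noteq> {}\<close> sub by blast
  obtain sx sy y where sxy: "sx \<in> {1, -1}" "sy \<in> {1, -1}" and zy: "z = log_chart sx sy y"
    by (rule log_chart_surj[OF z(1)])
  interpret S: star J E dir ht "tsign sx sy" M c \<Lambda> by (rule star_instance[OF sxy])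
  have in_ovals: "x \<in> S.ovals" if "emb (log_chart sx sy x) \<in> W" for x
    using ovals_chart_iff[OF sxy] inc dom log_chart_torus[OF sxy] that by blast
  show ?thesis
  proof (cases "(sx, sy) = (ox, oy)")
    case True
    then have "z \<in> oval" using in_ovals[of y] z zy unfolding oval_def by auto
    then have "W \<inter> emb ` oval \<noteq> {}" using z by blast
    then show ?thesis using components_eq[OF comp oval_component] by blast
  next
    case False
    \<comment> \<open>The part of \<open>W\<close> in this quadrant, in logarithmic coordinates. It
      is closed as a preimage of a closed set, and inherits maximality from
      \<open>W\<close>.\<close>
    define W1 where "W1 = (\<lambda>x. emb (log_chart sx sy x)) -` W"
    have cont: "continuous_on UNIV (\<lambda>x. emb (log_chart sx sy x))"
      by (rule continuous_on_compose2[OF emb_continuous log_chart_continuous])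
        (use log_chart_torus[OF sxy] in auto)
    have False
    proof (rule S.no_trapped_component)
      show "closed W1" unfolding W1_def
        using closed_components[OF curve_closure_closed comp] cont by (rule closed_vimage)
      show "W1 \<noteq> {}" using z zy by (auto simp: W1_def)
      show "W1 \<subseteq> S.ovals" using in_ovals by (auto simp: W1_def)
      show "tsign sx sy l = 1" if "(k, l) \<in> E" "tsign sx sy k = - 1" for k l
        using other_quadrant_sign[of k l sx sy] sxy False that by simp
      fix Q assume Q: "connected Q" "Q \<subseteq> {x. S.F x = 0}" "Q \<inter> W1 \<noteq> {}"
      let ?g = "\<lambda>x. emb (log_chart sx sy x)"
      have "connected (?g ` Q)"
        using Q(1) cont continuous_on_subset connected_continuous_image by blast
      moreover have "?g ` Q \<subseteq> C"
        using Q(2) curve_chart_iff[OF sxy] emb_curve_subset by blast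
      moreover have "W \<inter> ?g ` Q \<noteq> {}" using Q(3) by (auto simp: W1_def)
      ultimately have "?g ` Q \<subseteq> W" using components_maximal[OF comp] by blast
      then show "Q \<subseteq> W1" by (auto simp: W1_def)
    qed
    then show ?thesis ..
  qed
qed

end

section \<open>Choice of the constants and conclusion\<close>

lemma exists_large_gap:
  fixes A B K e :: real
  assumes "e > 0"
  obtains \<Lambda> where "\<Lambda> \<ge> 0" "\<Lambda> \<ge> B" "K * exp (A - \<Lambda>) < e"
proof -
  define \<Lambda> where "\<Lambda> = max 0 (max B (A - ln (e / (\<bar>K\<bar> + 1))))"
  have pos: "e / (\<bar>K\<bar> + 1) > 0" using assms by (simp add: add_nonneg_pos)
  have "A - \<Lambda> \<le> ln (e / (\<bar>K\<bar> + 1))" by (simp add: \<Lambda>_def)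
  then have "exp (A - \<Lambda>) \<le> e / (\<bar>K\<bar> + 1)" using pos by (metis exp_le_cancel_iff exp_ln)
  then have "(\<bar>K\<bar> + 1) * exp (A - \<Lambda>) \<le> e" by (simp add: field_simps add_nonneg_pos)
  moreover have "K * exp (A - \<Lambda>) < (\<bar>K\<bar> + 1) * exp (A - \<Lambda>)" by (intro mult_strict_right_mono) auto
  ultimately have "K * exp (A - \<Lambda>) < e" by linarith
  then show thesis using that[of \<Lambda>] by (simp add: \<Lambda>_def)
qed

theorem theorem5p2p1:
  fixes P :: "(real \<times> real) set" and p :: nat and b :: "nat \<Rightarrow> int \<times> int"
    and T :: "nat set set"
    and H :: "nat \<Rightarrow> (nat \<Rightarrow> rat) \<Rightarrow> rat"
    and s :: "nat set \<Rightarrow> nat \<Rightarrow> nat \<Rightarrow> nat"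
    and D c :: real
  assumes polygon: "convex_lattice_polygon P"
    and b_inj: "inj_on b {1..p+3}"
    and b_lat: "b ` {1..p+3} = lattice_points P"
    and b123: "b 1 = (1, 0)" "b 2 = (0, 1)" "b 3 = (0, 0)"
    and triang: "unimodular_triangulation P b (p+3) T"
    and sigma1: "{1, 2, 3} \<in> T"
    and H_expr: "\<And>\<sigma> k v. \<sigma> \<in> T \<Longrightarrow> k \<in> {1..p} \<Longrightarrow> v \<in> LQ b (p+3) \<Longrightarrow>
                   H k v = (\<Sum>j\<in>{1..p+3} - \<sigma>. of_nat (s \<sigma> k j) * v j)"
    and s_nondeg: "\<And>\<sigma> (w :: nat \<Rightarrow> rat). \<sigma> \<in> T \<Longrightarrow>
                   (\<forall>j\<in>{1..p+3} - \<sigma>. (\<Sum>k=1..p. w k * of_nat (s \<sigma> k j)) = 0) \<Longrightarrow>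
                   (\<forall>k\<in>{1..p}. w k = 0)"
    and D_bound: "\<And>i1 i2 i3 j (m' :: int) (n' :: int). is_flag b T i1 i2 i3 \<Longrightarrow> j \<in> {1..p+3} \<Longrightarrow>
                   pt b j = pt b i3 + real_of_int m' *\<^sub>R (pt b i1 - pt b i3)
                                    + real_of_int n' *\<^sub>R (pt b i2 - pt b i3) \<Longrightarrow>
                   sqrt (real_of_int m' ^ 2 + real_of_int n' ^ 2) \<le> D"
    and c_pos: "c > 0"
    and c_bound: "(1 + c) powr (2 * D) < 4 / 3"
  shows "\<exists>\<epsilon>>0. \<forall>q :: nat \<Rightarrow> real.
           (\<forall>k\<in>{1..p}. q k \<noteq> 0 \<and> \<bar>q k\<bar> < \<epsilon>) \<and>
           (\<forall>i\<in>{1..p+3}. (odd (fst (b i)) \<and> odd (snd (b i)) \<longrightarrow> a_coef p s q i < 0) \<and>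
                           (even (fst (b i)) \<or> even (snd (b i)) \<longrightarrow> a_coef p s q i > 0))
           \<longrightarrow> (\<forall>i\<in>{1..p+3}. pt b i \<in> interior P \<longrightarrow>
                 (\<exists>!W. W \<in> components (curve_closure b p s q) \<and>
                       W \<subseteq> toric_embed b (p+3) ` real_torus \<and>
                       (\<forall>x0 y0. (x0, y0) \<in> real_torus \<longrightarrow> toric_embed b (p+3) (x0, y0) \<in> W \<longrightarrow>
                          (\<forall>j\<in>{1..p+3}. j \<noteq> i \<longrightarrow>
                             (1 + c) * \<bar>a_coef p s q i * x0 powi fst (b i) * y0 powi snd (b i)\<bar>
                             > \<bar>a_coef p s q j * x0 powi fst (b j) * y0 powi snd (b j)\<bar>))))"
proof -
  \<comment> \<open>Coordinates of lattice points are integers, so the bound \<open>D\<close> can be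
    rounded down.\<close>
  define M where "M = nat \<lfloor>D\<rfloor>"
  have "1 \<le> D"
  proof -
    \<comment> \<open>In this flag \<open>b 1\<close> has coordinates 1 and 0, whose norm is
      1.\<close>
    have "is_flag b T 1 2 3" using sigma1 b123 by (simp add: is_flag_def pt_def det2_def)
    from D_bound[OF this, of 1 1 0] show ?thesis by simp
  qed
  then have MD: "real M \<le> D" by (simp add: M_def)
  have abs_le_M: "\<bar>m\<bar> \<le> int M \<and> \<bar>n\<bar> \<le> int M" if "sqrt (real_of_int m ^ 2 + real_of_int n ^ 2) \<le> D" for m n
  proof -
    have "\<bar>real_of_int m\<bar> \<le> D" "\<bar>real_of_int n\<bar> \<le> D"
      using that
        real_sqrt_ge_abs1[of "real_of_int m" "real_of_int n"]
        real_sqrt_ge_abs2[where x = "real_of_int m" and y = "real_of_int n"] by linarith+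
    then have "of_int \<bar>m\<bar> \<le> D" "of_int \<bar>n\<bar> \<le> D" by simp_all
    then have "\<bar>m\<bar> \<le> \<lfloor>D\<rfloor>" "\<bar>n\<bar> \<le> \<lfloor>D\<rfloor>" by (simp_all only: le_floor_iff)
    then show ?thesis using \<open>1 \<le> D\<close> by (simp add: M_def)
  qed
  \<comment> \<open>Bernoulli's inequality turns the bound on \<open>(1 + c) powr (2 * D)\<close>
    into a linear one, as \<open>M \<le> D \<le> 2 * D\<close>.\<close>
  have Mc: "real M * c \<le> 1 / 3"
  proof -
    have "1 + real M * c \<le> (1 + c) ^ M" using Bernoulli_inequality[of c M] c_pos by simp
    also have "\<dots> = (1 + c) powr real M" using c_pos by (simp add: powr_realpow)
    also have "\<dots> \<le> (1 + c) powr (2 * D)" using c_pos MD \<open>1 \<le> D\<close> by (intro powr_mono) auto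
    also have "\<dots> < 4 / 3" by (rule c_bound)
    finally show ?thesis by simp
  qed
  interpret U: unimodular_polygon P b "p + 3" T
    using b_inj triang by unfold_locales
  interpret G: triangulated_polygon P b "p + 3" T M
  proof
    fix i k l j and m n :: int
    let ?d = "\<lambda>j. pt b j - pt b i"
    assume T: "{i, k, l} \<in> T" and j: "j \<in> {1..p+3}"
      and eq: "?d j = of_int m *\<^sub>R ?d k + of_int n *\<^sub>R ?d l"
    have det: "det2 (?d k) (?d l) \<noteq> 0" using U.tri_det[OF T] by auto
    show "\<bar>m\<bar> \<le> int M \<and> \<bar>n\<bar> \<le> int M"
    \<comment> \<open>Flags are ordered counterclockwise; for the other orientation \<open>k\<close>
      and \<open>l\<close> change places, and with them \<open>m\<close> and
      \<open>n\<close>.\<close>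
    proof (cases "det2 (?d k) (?d l) > 0")
      case True
      then have "is_flag b T k l i" using T by (simp add: is_flag_def insert_commute)
      from D_bound[OF this j, of m n] eq show ?thesis
        by (intro abs_le_M) (simp add: algebra_simps)
    next
      case False
      then have "det2 (?d l) (?d k) > 0" using det det2_lin(3)[of "?d k" "?d l"] by linarith
      then have "is_flag b T l k i" using T by (simp add: is_flag_def insert_commute)
      from D_bound[OF this j, of n m] eq have "\<bar>n\<bar> \<le> int M \<and> \<bar>m\<bar> \<le> int M"
        by (intro abs_le_M) (simp add: algebra_simps)
      then show ?thesis by simp
    qed
  qed
  \<comment> \<open>\<open>\<Lambda>\<close> depends only on \<open>p\<close>, \<open>M\<close> and
    \<open>c\<close>, hence neither on \<open>q\<close> nor on \<open>i\<close>, and so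
    \<open>exp (- \<Lambda>)\<close> serves as a uniform \<open>\<epsilon>\<close>.\<close>
  obtain \<Lambda> where \<Lambda>: "\<Lambda> \<ge> 0" "\<Lambda> \<ge> 10 * real (p + 2) * real M + 5 * real (p + 2)"
    "real (p + 2) * real M * exp (real M * (2 * real (p + 2) + 2 * c) - \<Lambda>) < min c (1 / 18)"
    using exists_large_gap[of "min c (1 / 18)"] c_pos by (metis min_less_iff_conj zero_less_divide_1_iff zero_less_numeral)
  show ?thesis
  proof (intro exI[of _ "exp (- \<Lambda>)"] conjI allI impI ballI)
    fix q i
    assume q: "(\<forall>k\<in>{1..p}. q k \<noteq> 0 \<and> \<bar>q k\<bar> < exp (- \<Lambda>)) \<and>
           (\<forall>i\<in>{1..p+3}. (odd (fst (b i)) \<and> odd (snd (b i)) \<longrightarrow> a_coef p s q i < 0) \<and>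
                           (even (fst (b i)) \<or> even (snd (b i)) \<longrightarrow> a_coef p s q i > 0))"
      and i: "i \<in> {1..p+3}" "pt b i \<in> interior P"
    interpret S: mirror_setup P b p T M s q c \<Lambda> i
    proof
      show "b 1 = (1, 0)" "b 2 = (0, 1)" "b 3 = (0, 0)" by (rule b123)+
      show "sgn (a_coef p s q j) = (if odd (fst (b j)) \<and> odd (snd (b j)) then - 1 else 1)"
        if "j \<in> {1..p+3}" for j
        using q that by (cases "odd (fst (b j)) \<and> odd (snd (b j))") auto
      fix k l j and m n :: int
      let ?d = "\<lambda>j. pt b j - pt b i"
      assume T: "{i, k, l} \<in> T" and j: "j \<in> {1..p+3} - {i, k, l}"
        and eq: "?d j = of_int m *\<^sub>R ?d k + of_int n *\<^sub>R ?d l"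
      have "real_of_int (fst (b j) - fst (b i)) = of_int (m * (fst (b k) - fst (b i)) + n * (fst (b l) - fst (b i)))"
        "real_of_int (snd (b j) - snd (b i)) = of_int (m * (snd (b k) - snd (b i)) + n * (snd (b l) - snd (b i)))"
        using eq by (simp_all add: pt_def prod_eq_iff)
      then have rel: "fst (b j) - fst (b i) = m * (fst (b k) - fst (b i)) + n * (fst (b l) - fst (b i))"
        "snd (b j) - snd (b i) = m * (snd (b k) - snd (b i)) + n * (snd (b l) - snd (b i))"
        by (simp_all only: of_int_eq_iff)
      have "i \<noteq> k" "i \<noteq> l" "k \<noteq> l" using U.tri_det[OF T] by (auto simp: det2_def)
      then have card: "card {i, k, l} = 3" by simp
      show "ln \<bar>a_coef p s q j\<bar> - of_int m * ln \<bar>a_coef p s q k\<bar> - of_int n * ln \<bar>a_coef p s q l\<bar>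
        - (1 - of_int m - of_int n) * ln \<bar>a_coef p s q i\<bar> \<le> - \<Lambda>"
        by (rule coef_gap[where H = H, OF U.T_sub[OF T] card H_expr[OF T] H_expr[OF sigma1] s_nondeg[OF T] j rel])
          (use q \<Lambda>(1) in auto)
    qed (use i c_pos Mc \<Lambda> in auto)
    have dom: "S.dominated_component W \<longleftrightarrow> W \<in> components (curve_closure b p s q) \<and>
                       W \<subseteq> toric_embed b (p+3) ` real_torus \<and>
                       (\<forall>x0 y0. (x0, y0) \<in> real_torus \<longrightarrow> toric_embed b (p+3) (x0, y0) \<in> W \<longrightarrow>
                          (\<forall>j\<in>{1..p+3}. j \<noteq> i \<longrightarrow>
                             (1 + c) * \<bar>a_coef p s q i * x0 powi fst (b i) * y0 powi snd (b i)\<bar>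
                             > \<bar>a_coef p s q j * x0 powi fst (b j) * y0 powi snd (b j)\<bar>))" for W
      by (simp add: S.dominated_component_def S.dominant_def S.h_def Ball_def split_paired_All)
    show "\<exists>!W. W \<in> components (curve_closure b p s q) \<and>
                       W \<subseteq> toric_embed b (p+3) ` real_torus \<and>
                       (\<forall>x0 y0. (x0, y0) \<in> real_torus \<longrightarrow> toric_embed b (p+3) (x0, y0) \<in> W \<longrightarrow>
                          (\<forall>j\<in>{1..p+3}. j \<noteq> i \<longrightarrow>
                             (1 + c) * \<bar>a_coef p s q i * x0 powi fst (b i) * y0 powi snd (b i)\<bar>
                             > \<bar>a_coef p s q j * x0 powi fst (b j) * y0 powi snd (b j)\<bar>))"
      unfolding dom[symmetric] using S.oval_dominated S.dominated_unique by blast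
  qed simp
qed

end
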